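(* For the step set $\mathcal A$, $$Q_{\mathcal A}(x,0,\tfrac12)=2\sum_{n\ge0}(2^{2n+2}-1)\frac{(-1)^n}{n+1}B_{2n+2}x^{2n}.$$ In particular: (a) $Q_{\mathcal A}(x,0,\tfrac12)$ is strongly differentially transcendental; (b) its coefficient sequence $(a_n)_{n\ge0}=(1,0,\tfrac12,0,1,0,\tfrac{17}4,0,31,0,\tfrac{691}{2},\dots)$, defined by $Q_{\mathcal A}(x,0,\tfrac12)=\sum_{n\ge0}a_nx^n$, satisfies $2a_{n+1}=\sum_{\ell=1}^n\binom n\ell a_{\ell-1}a_{n-\ell}$ for all $n\ge0$.
   Context: Let $\mathbb N=\{0,1,2,\dots\}$ and $\mathcal A=\{(-1,1),(1,1),(1,-1)\}$. $\#_{\mathcal A}\{(0,0)\xrightarrow{n}(i,j)\}$ is the number of sequences $p_0=(0,0),p_1,\dots,p_n=(i,j)$ of points of $\mathbb N^2$ with $p_m-p_{m-1}\in\mathcal A$, and $Q_{\mathcal A}(x,0,\tfrac12)=\sum_{i\ge0}\big(\sum_{n\ge0}\#_{\mathcal A}\{(0,0)\xrightarrow{n}(i,0)\}2^{-n}\big)x^i$ (the inner series converge). Bernoulli numbers: $\sum_{n\ge0}B_n\frac{x^n}{n!}=\frac{x}{e^x-1}$. A power series $f\in\mathbb C[[x]]$ is strongly differentially transcendental if there is no nonzero polynomial $P$ with coefficients in the field $\mathbb C(\{x\})$ of germs at $0$ of meromorphic functions such that $P(f,f',\dots,f^{(m)})=0$ for some $m$. *)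

theory Defs
  imports "HOL-Analysis.Analysis" "HOL-Analysis.FPS_Convergence"
    "HOL-Computational_Algebra.Formal_Laurent_Series"
begin

definition stepsA :: "(int \<times> int) set" where
  "stepsA = {(-1, 1), (1, 1), (1, -1)}"

definition walk_pos :: "(int \<times> int) list \<Rightarrow> nat \<Rightarrow> int \<times> int" where
  "walk_pos s k = (\<Sum>t\<leftarrow>take k s. fst t, \<Sum>t\<leftarrow>take k s. snd t)"

definition walk_count :: "nat \<Rightarrow> int \<Rightarrow> int \<Rightarrow> nat" where
  "walk_count n i j = card {s. s \<in> lists stepsA \<and> length s = n \<and>
      (\<forall>k\<le>n. fst (walk_pos s k) \<ge> 0 \<and> snd (walk_pos s k) \<ge> 0) \<and>
      walk_pos s n = (i, j)}"

definition QA_coeff :: "nat \<Rightarrow> real" where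
  "QA_coeff i = (\<Sum>n. real (walk_count n (int i) 0) / 2 ^ n)"

definition QA_half :: "complex fps" where
  "QA_half = Abs_fps (\<lambda>i. complex_of_real (QA_coeff i))"

definition bernoulli :: "nat \<Rightarrow> real" where
  "bernoulli n = fact n * fps_nth (fps_X / (fps_exp 1 - 1)) n"

definition meromorphic_germ :: "complex fls \<Rightarrow> bool" where
  "meromorphic_germ g \<longleftrightarrow> fps_conv_radius (fls_base_factor_to_fps g) > 0"

text \<open>A polynomial in the variables y_0..y_m with coefficients in C({x}) is given by a
  finitely supported coefficient function on exponent vectors e (with e i = 0 for i > m);
  it is evaluated at (f, f', ..., f^(m)).\<close>
definition strongly_diff_transcendental :: "complex fps \<Rightarrow> bool" where
  "strongly_diff_transcendental f \<longleftrightarrow>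
     \<not> (\<exists>m (c :: (nat \<Rightarrow> nat) \<Rightarrow> complex fls).
          finite {e. c e \<noteq> 0} \<and> {e. c e \<noteq> 0} \<noteq> {} \<and>
          (\<forall>e. c e \<noteq> 0 \<longrightarrow> meromorphic_germ (c e) \<and> (\<forall>i>m. e i = 0)) \<and>
          (\<Sum>e\<in>{e. c e \<noteq> 0}. c e * (\<Prod>i\<le>m. fps_to_fls ((fps_deriv ^^ i) f) ^ e i)) = 0)"

end

theory Submission
  imports Defs "HOL-Complex_Analysis.Complex_Analysis"
begin

text \<open>
  A north-east step raises \<open>i + j\<close> by \<open>2\<close>, the other two steps preserve it; so at \<open>t = 1/2\<close> the model is a
  simple random walk on each antidiagonal, killed at its ends and fed from the previous one. Its Green
  function is finite and the kernel method, with the kernel parametrised rationally by \<open>z = 1 - \<i> x\<close>,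
  gives for \<open>f = x\<^sup>2 Q(x,0,1/2)\<close> and the Moebius map \<open>\<mu> = x / (1 - \<i> x)\<close> the equation
  \<open>f + f \<circ> \<mu> = 2 x \<mu>\<close>. The formal Borel transform turns composition with \<open>\<mu>\<close> into multiplication by
  \<open>exp (\<i> \<xi>)\<close>, so the Borel transform of \<open>f\<close> is \<open>T = 2 tan (\<xi> / 2)\<close>; this yields the Bernoulli numbers
  and, from \<open>2 T'' = T T'\<close>, the recurrence.

  For the transcendence, \<open>x\<^sup>2 d/dx\<close> commutes with composition with \<open>\<mu>\<close>, so the iterates \<open>f\<^sub>i\<close> of \<open>f\<close>
  under it satisfy \<open>f\<^sub>i + f\<^sub>i \<circ> \<mu> = r\<^sub>i\<close> with \<open>r\<^sub>i\<close> convergent. As in Ostrowski's theorem, an algebraic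
  relation between the \<open>f\<^sub>i\<close> of minimal degree, normalised and compared with its image under \<open>\<mu>\<close>, has
  constant leading coefficients, and its next coefficients produce a linear relation with constant
  coefficients: some nontrivial combination \<open>\<Sum> l\<^sub>i f\<^sub>i\<close> converges. Its Borel transform
  \<open>(\<Sum> l\<^sub>i \<xi>\<^sup>i) 2 tan (\<xi> / 2)\<close> would then be entire, although \<open>tan (\<xi> / 2)\<close> has infinitely many poles.
\<close>

section \<open>The Borel transform of the functional equation\<close>

definition moebius :: "complex fps" where
  "moebius = fps_X / (1 - fps_const \<i> * fps_X)"

lemma moebius_eq: "moebius * (1 - fps_const \<i> * fps_X) = fps_X"
  unfolding moebius_def by (subst fps_divide_unit) (auto simp: mult.assoc inverse_mult_eq_1)

lemma moebius_rec: "moebius = fps_X + fps_const \<i> * fps_X * moebius"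
  using moebius_eq by (simp add: algebra_simps)

lemma moebius_nth_0 [simp]: "fps_nth moebius 0 = 0"
  by (subst moebius_rec) (simp add: mult.assoc)

lemma moebius_power_Suc:
  "moebius ^ Suc k = fps_X * moebius ^ k + fps_const \<i> * (fps_X * moebius ^ Suc k)"
proof -
  have "moebius ^ Suc k = (fps_X + fps_const \<i> * fps_X * moebius) * moebius ^ k"
    by (metis moebius_rec power_Suc)
  also have "\<dots> = fps_X * moebius ^ k + fps_const \<i> * (fps_X * moebius ^ Suc k)"
    by (simp only: power_Suc ring_distribs mult.assoc)
  finally show ?thesis .
qed

text \<open>Read coefficientwise, \<open>moebius_power_Suc\<close> is Pascal's rule with weight
  \<open>\<i>\<close>. The result is the negative binomial series of
  \<open>x^(k+1) (1 - \<i> x)^(-k-1)\<close>.\<close>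

lemma moebius_power_nth:
  "fps_nth (moebius ^ Suc k) (Suc n) = of_nat (n choose k) * \<i> ^ (n - k)"
proof (induction n arbitrary: k)
  case 0
  from moebius_power_Suc have "fps_nth (moebius ^ Suc k) (Suc 0) = fps_nth (moebius ^ k) 0 + \<i> * fps_nth (moebius ^ Suc k) 0"
    by (metis fps_add_nth fps_mult_left_const_nth diff_Suc_1 nat.distinct(1) fps_X_mult_nth)
  then show ?case by (cases k) auto
next
  case (Suc n)
  from moebius_power_Suc have eq: "fps_nth (moebius ^ Suc k) (Suc (Suc n)) = fps_nth (moebius ^ k) (Suc n) + \<i> * fps_nth (moebius ^ Suc k) (Suc n)"
    by (metis fps_add_nth fps_mult_left_const_nth diff_Suc_1 nat.distinct(1) fps_X_mult_nth)
  show ?case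
  proof (cases k)
    case 0
    then show ?thesis unfolding eq Suc by simp
  next
    case k: (Suc j)
    show ?thesis
    \<comment> \<open>For \<open>k > n\<close> the truncated exponent \<open>n - k\<close> does no
      harm, because \<open>n choose k\<close> is then \<open>0\<close>.\<close>
    proof (cases "k \<le> n")
      case True
      then have "n - j = Suc (n - k)" using k by simp
      then show ?thesis unfolding eq Suc unfolding k using Suc[of j] by (simp add: algebra_simps)
    next
      case False
      then show ?thesis unfolding eq Suc unfolding k using Suc[of j] k by (simp add: algebra_simps)
    qed
  qed
qed

section \<open>The formal Borel transform\<close>

definition borel_fps :: "complex fps \<Rightarrow> complex fps" where
  "borel_fps F = Abs_fps (\<lambda>n. fps_nth F (Suc n) / fact n)"

lemma borel_fps_nth [simp]: "fps_nth (borel_fps F) n = fps_nth F (Suc n) / fact n"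
  by (simp add: borel_fps_def)

lemma borel_fps_add: "borel_fps (F + G) = borel_fps F + borel_fps G"
  by (rule fps_ext) (simp add: add_divide_distrib)

lemma borel_fps_const_mult: "borel_fps (fps_const c * F) = fps_const c * borel_fps F"
  by (rule fps_ext) simp

lemma borel_fps_sum: "borel_fps (sum F A) = (\<Sum>i\<in>A. borel_fps (F i))"
  by (rule fps_ext) (simp add: fps_sum_nth sum_divide_distrib)

text \<open>In the coordinate \<open>1/x\<close> the Moebius map is translation by
  \<open>-\<i>\<close>, and a Borel transform turns translations into exponential factors. The index
  shift \<open>x^(k+1)\<close> to \<open>\<xi>^k / k!\<close> makes the binomial coefficients of
  \<open>moebius_power_nth\<close> split into a Cauchy product.\<close>

lemma borel_fps_compose_moebius: "borel_fps (F oo moebius) = fps_exp \<i> * borel_fps F"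
proof (rule fps_ext)
  fix n
  have "fps_nth (F oo moebius) (Suc n) = (\<Sum>i=0..Suc n. fps_nth F i * fps_nth (moebius ^ i) (Suc n))"
    by (simp add: fps_compose_nth)
  \<comment> \<open>The term of \<open>moebius ^ 0\<close> vanishes in positive degree, so the
    constant coefficient of \<open>F\<close>, which \<open>borel_fps\<close> discards, does not
    enter.\<close>
  also have "\<dots> = (\<Sum>i=0..n. fps_nth F (Suc i) * fps_nth (moebius ^ Suc i) (Suc n))"
    by (subst sum.atLeast0_atMost_Suc_shift) simp
  finally have "fps_nth (borel_fps (F oo moebius)) n
      = (\<Sum>i=0..n. fps_nth F (Suc i) * (of_nat (n choose i) * \<i> ^ (n - i)) / fact n)"
    by (simp add: moebius_power_nth sum_divide_distrib del: power_Suc)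
  also have "\<dots> = (\<Sum>i=0..n. fps_nth F (Suc i) / fact i * (\<i> ^ (n - i) / fact (n - i)))"
    by (rule sum.cong) (auto simp: binomial_fact)
  also have "\<dots> = fps_nth (borel_fps F * fps_exp \<i>) n" by (simp add: fps_mult_nth)
  finally show "fps_nth (borel_fps (F oo moebius)) n = fps_nth (fps_exp \<i> * borel_fps F) n"
    by (simp add: mult.commute)
qed

text \<open>The operator \<open>x^2 d/dx\<close> sends \<open>x^(k+1)\<close> to
  \<open>(k+1) x^(k+2)\<close>, and the factor \<open>k+1\<close> cancels against the larger
  factorial.\<close>

lemma borel_fps_deriv: "borel_fps (fps_X ^ 2 * fps_deriv F) = fps_X * borel_fps F"
proof (rule fps_ext)
  fix n
  show "fps_nth (borel_fps (fps_X ^ 2 * fps_deriv F)) n = fps_nth (fps_X * borel_fps F) n"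
    by (cases n) (simp_all add: fps_X_power_mult_nth fact_Suc divide_simps del: of_nat_Suc)
qed

lemma borel_fps_rhs:
  "borel_fps (2 * fps_X * moebius) = fps_const (-2 * \<i>) * (fps_exp \<i> - 1)"
proof (rule fps_ext)
  fix n
  have "fps_nth (2 * fps_X * moebius) (Suc n) = 2 * fps_nth moebius n"
    by (simp add: mult.assoc)
  also have "fps_nth moebius n = (if n = 0 then 0 else \<i> ^ (n - 1))"
    using moebius_power_nth[of 0 "n-1"] by (cases n) auto
  finally show "fps_nth (borel_fps (2 * fps_X * moebius)) n = fps_nth (fps_const (-2 * \<i>) * (fps_exp \<i> - 1)) n"
    by (cases n) (auto simp: algebra_simps simp del: fact_Suc)
qed

text \<open>The series \<open>c \<xi> / (exp (c \<xi>) - 1)\<close>. The scaling is put on the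
  coefficients because \<open>bernoulli\<close> is real, while \<open>c\<close> will be
  \<open>\<i>\<close> and \<open>2 * \<i>\<close>.\<close>

definition bern_fps :: "complex \<Rightarrow> complex fps" where
  "bern_fps c = Abs_fps (\<lambda>n. c ^ n * of_real (bernoulli n / fact n))"

text \<open>The coefficient of degree \<open>n\<close> carries the factor \<open>c ^ n\<close>,
  which reduces the identity to the real one at \<open>c = 1\<close>. There the division is exact,
  since the divisor has subdegree \<open>1\<close>.\<close>

lemma bern_fps_mult: "bern_fps c * (fps_exp c - 1) = fps_const c * fps_X"
proof (rule fps_ext)
  fix n
  define \<beta> :: "real fps" where "\<beta> = fps_X / (fps_exp 1 - 1)"
  have "subdegree (fps_exp 1 - 1 :: real fps) = 1"
    by (rule subdegreeI) auto
  then have "\<beta> * (fps_exp 1 - 1) = fps_X"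
    unfolding \<beta>_def by (intro dvd_div_mult_self) (auto simp: fps_dvd_iff)
  then have "fps_nth (\<beta> * (fps_exp 1 - 1)) n = fps_nth (fps_X :: real fps) n" by simp
  then have r: "(\<Sum>i=0..n. fps_nth \<beta> i * (1 / fact (n - i) - (if n - i = 0 then 1 else 0))) = (if n = 1 then 1 else 0)"
    by (simp add: fps_mult_nth fps_X_def)
  have "fps_nth (bern_fps c * (fps_exp c - 1)) n
      = (\<Sum>i=0..n. c ^ i * of_real (fps_nth \<beta> i) * (c ^ (n - i) / fact (n - i) - (if n - i = 0 then 1 else 0)))"
    by (simp add: fps_mult_nth bern_fps_def bernoulli_def \<beta>_def)
  also have "\<dots> = (\<Sum>i=0..n. c ^ n * of_real (fps_nth \<beta> i * (1 / fact (n - i) - (if n - i = 0 then 1 else 0))))"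
  proof (rule sum.cong)
    fix i assume "i \<in> {0..n}"
    then have "c ^ n = c ^ i * c ^ (n - i)" by (simp flip: power_add)
    then show "c ^ i * of_real (fps_nth \<beta> i) * (c ^ (n - i) / fact (n - i) - (if n - i = 0 then 1 else 0))
      = c ^ n * of_real (fps_nth \<beta> i * (1 / fact (n - i) - (if n - i = 0 then 1 else 0)))"
      by (auto simp: algebra_simps)
  qed simp
  also have "\<dots> = c ^ n * of_real (if n = 1 then 1 else 0)"
    unfolding r[symmetric] by (simp add: sum_distrib_left)
  finally show "fps_nth (bern_fps c * (fps_exp c - 1)) n = fps_nth (fps_const c * fps_X) n"
    by (simp add: fps_X_def)
qed

section \<open>The tangent as Borel transform of a solution of the functional equation\<close>

context
  fixes F T :: "complex fps"
  assumes FE: "F + (F oo moebius) = 2 * fps_X * moebius"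
  assumes T: "T = borel_fps F"
begin

text \<open>The image of the functional equation under the Borel transform; it says that
  \<open>T = 2 tan (\<xi> / 2)\<close>.\<close>

lemma tan_eq: "T * (1 + fps_exp \<i>) = fps_const (-2 * \<i>) * (fps_exp \<i> - 1)"
  using arg_cong[OF FE, of borel_fps]
  unfolding borel_fps_rhs borel_fps_add borel_fps_compose_moebius T by (simp only: ring_distribs mult_ac mult_1_right mult_1_left)

lemma exp_plus_1_nz: "1 + fps_exp \<i> \<noteq> (0 :: complex fps)"
proof
  assume "1 + fps_exp \<i> = (0 :: complex fps)"
  then have "fps_nth (1 + fps_exp \<i> :: complex fps) 0 = fps_nth 0 0" by simp
  then show False by simp
qed

text \<open>With the imaginary unit replaced by a series \<open>j\<close> subject to
  \<open>j * j = -1\<close>, the computations below become identities in a commutative ring.\<close>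

lemma tan_eq':
  obtains j :: "complex fps" where "j = fps_const \<i>" "j * j = -1" "T * (1 + fps_exp \<i>) = -2 * j * (fps_exp \<i> - 1)"
proof
  show "fps_const \<i> * fps_const \<i> = (-1 :: complex fps)"
    by (simp flip: fps_const_neg)
  have "fps_const (-2 * \<i>) = -2 * (fps_const \<i> :: complex fps)"
    by (simp only: fps_const_mult[symmetric] fps_const_neg[symmetric] numeral_fps_const)
  then show "T * (1 + fps_exp \<i>) = -2 * fps_const \<i> * (fps_exp \<i> - 1)"
    using tan_eq by metis
qed simp

text \<open>The Riccati equation of \<open>2 tan (\<xi> / 2)\<close>, verified after multiplication
  by \<open>(1 + ?E) ^ 2\<close> to clear denominators.\<close>

lemma tan_deriv: "4 * fps_deriv T = T ^ 2 + 4"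
proof -
  obtain j :: "complex fps" where j: "j = fps_const \<i>" and j2: "j * j = -1"
    and e: "T * (1 + fps_exp \<i>) = -2 * j * (fps_exp \<i> - 1)" using tan_eq' .
  let ?E = "fps_exp \<i> :: complex fps"
  have dE: "fps_deriv ?E = j * ?E" by (simp add: j)
  have dj: "fps_deriv j = 0" by (simp add: j)
  have d: "fps_deriv T * (1 + ?E) + T * (j * ?E) = - 2 * j * (j * ?E)"
    using arg_cong[OF e, of fps_deriv] by (simp add: dE dj algebra_simps del: fps_exp_deriv)
  have "4 * fps_deriv T * (1 + ?E) ^ 2 = 4 * (1 + ?E) * (fps_deriv T * (1 + ?E))"
    by (simp add: power2_eq_square algebra_simps)
  also have "fps_deriv T * (1 + ?E) = - 2 * j * (j * ?E) - T * (j * ?E)"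
    unfolding d[symmetric] by simp
  also have "4 * (1 + ?E) * \<dots> = - 8 * ?E * (1 + ?E) * (j * j) - 4 * j * ?E * (T * (1 + ?E))"
    by (simp add: algebra_simps)
  also have "\<dots> = - 8 * ?E * (1 + ?E) * (j * j) + 8 * (j * j) * ?E * (?E - 1)"
    unfolding e by (simp add: algebra_simps)
  also have "\<dots> = 16 * ?E" unfolding j2 by (simp add: algebra_simps)
  also have "\<dots> = 4 * (j * j) * (?E - 1)^2 + 4 * (1 + ?E)^2"
    unfolding j2 by (simp add: algebra_simps power2_eq_square)
  also have "\<dots> = (T * (1 + ?E))^2 + 4 * (1 + ?E)^2"
    unfolding e by (simp add: algebra_simps power2_eq_square)
  also have "\<dots> = (T^2 + 4) * (1 + ?E)^2" by (simp add: algebra_simps power2_eq_square)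
  finally show ?thesis using exp_plus_1_nz by simp
qed

lemma tan_deriv_deriv: "2 * fps_deriv (fps_deriv T) = T * fps_deriv T"
proof -
  have "4 * fps_deriv (fps_deriv T) = 2 * (T * fps_deriv T)"
    using arg_cong[OF tan_deriv, of fps_deriv] by (simp add: power2_eq_square)
  then have "2 * (2 * fps_deriv (fps_deriv T)) = 2 * (T * fps_deriv T)" by (simp add: mult.assoc)
  then show ?thesis by (simp only: mult_cancel_left) simp
qed

text \<open>Multiplying \<open>tan_eq\<close> by \<open>exp (-\<i> \<xi> / 2)\<close> makes it
  symmetric. In this form the poles of the tangent show up as zeros of the cosine, with no
  division.\<close>

lemma tan_cos: "T * fps_cos (1/2) = 2 * fps_sin (1/2)"
proof -
  obtain j :: "complex fps" where j: "j = fps_const \<i>" and j2: "j * j = -1"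
    and e: "T * (1 + fps_exp \<i>) = -2 * j * (fps_exp \<i> - 1)" using tan_eq' .
  define h h' :: "complex fps" where "h = fps_exp (\<i> * (1/2))" and "h' = fps_exp (- (\<i> * (1/2)))"
  have hh: "fps_exp \<i> = h * h" by (simp add: h_def flip: fps_exp_add_mult)
  have h1: "h * h' = 1" by (simp add: h_def h'_def flip: fps_exp_add_mult)
  have h: "h = fps_cos (1/2) + j * fps_sin (1/2)" "h' = fps_cos (1/2) - j * fps_sin (1/2)"
    unfolding h_def h'_def j by (rule fps_exp_ii_sin_cos fps_exp_minus_ii_sin_cos)+
  have "T * (1 + h * h) * h' = -2 * j * (h * h - 1) * h'" using e hh by simp
  moreover have "T * (1 + h * h) * h' = T * (h' + h * (h * h'))" by (simp add: algebra_simps)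
  moreover have "-2 * j * (h * h - 1) * h' = -2 * j * (h * (h * h') - h')" by (simp add: algebra_simps)
  ultimately have "T * (h' + h) = -2 * j * (h - h')" using h1 by simp
  then have "2 * (T * fps_cos (1/2)) = -4 * (j * j) * fps_sin (1/2)"
    unfolding h by (simp add: algebra_simps)
  also have "\<dots> = 2 * (2 * fps_sin (1/2))" unfolding j2 by simp
  finally show ?thesis by (simp only: mult_cancel_left) simp
qed

text \<open>Partial fractions: \<open>1 / (E + 1) = 1 / (E - 1) - 2 / (E^2 - 1)\<close> with
  \<open>E = exp (\<i> \<xi>)\<close>, so \<open>\<xi> T\<close> combines the Bernoulli series for
  \<open>\<i>\<close> and \<open>2 * \<i>\<close>.\<close>

lemma tan_nth_bernoulli:
  "fps_nth T (Suc k) = - 4 * (2 ^ (k + 2) - 1) * \<i> ^ (k + 2) * of_real (bernoulli (k + 2)) / fact (k + 2)"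
proof -
  obtain j :: "complex fps" where j: "j = fps_const \<i>" and j2: "j * j = -1"
    and e: "T * (1 + fps_exp \<i>) = -2 * j * (fps_exp \<i> - 1)" using tan_eq' .
  let ?E = "fps_exp \<i> :: complex fps"
  have b: "bern_fps c * (fps_exp c - 1) = fps_const c * fps_X" for c by (rule bern_fps_mult)
  define b1 b2 where "b1 = bern_fps \<i>" and "b2 = bern_fps (2 * \<i>)"
  have b1: "b1 * (?E - 1) = j * fps_X" using b[of \<i>] by (simp add: b1_def j)
  have EE: "fps_exp (2 * \<i>) = ?E * ?E" by (simp flip: fps_exp_add_mult)
  have "fps_const (2 * \<i>) = 2 * j" unfolding j by (simp only: fps_const_mult[symmetric] numeral_fps_const)
  then have b2: "b2 * (?E * ?E - 1) = 2 * j * fps_X" using b[of "2 * \<i>"] EE by (simp add: b2_def)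
  have "fps_X * T * (?E * ?E - 1) = fps_X * (T * (1 + ?E)) * (?E - 1)" by (simp add: algebra_simps)
  also have "\<dots> = -2 * (j * fps_X * (?E * ?E - 1) - 2 * (j * fps_X) * (1 + ?E) + 2 * (2 * j * fps_X))"
    unfolding e by (simp add: algebra_simps)
  also have "\<dots> = (-2 * (j * fps_X - 2 * b1 + 2 * b2)) * (?E * ?E - 1)"
    unfolding b1[symmetric] b2[symmetric] by (simp add: algebra_simps)
  finally have "fps_X * T = -2 * (j * fps_X - 2 * b1 + 2 * b2) \<or> ?E * ?E - 1 = 0"
    by (metis mult_cancel_right)
  moreover have "?E * ?E - 1 \<noteq> 0"
  proof
    assume "?E * ?E - 1 = 0"
    then have "fps_nth (fps_exp (2 * \<i>) - 1 :: complex fps) 1 = 0" using EE by simp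
    then show False by simp
  qed
  \<comment> \<open>From degree \<open>2\<close> on, the linear term \<open>j * fps_X\<close>
    contributes nothing.\<close>
  ultimately have "fps_nth (fps_X * T) (k + 2) = fps_nth (-2 * (j * fps_X - 2 * b1 + 2 * b2)) (k + 2)" by simp
  also have "\<dots> = - 2 * (- 2 * fps_nth b1 (k + 2) + 2 * fps_nth b2 (k + 2))"
    by (simp add: j numeral_fps_const)
  also have "\<dots> = - 4 * (2 ^ (k + 2) - 1) * \<i> ^ (k + 2) * of_real (bernoulli (k + 2)) / fact (k + 2)"
    by (simp add: b1_def b2_def bern_fps_def power_mult_distrib field_simps del: power_Suc fact_Suc)
  finally show ?thesis by simp
qed

end

section \<open>Green function of the walk\<close>

definition walks :: "nat \<Rightarrow> int \<Rightarrow> int \<Rightarrow> (int \<times> int) list set" where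
  "walks n i j = {s. s \<in> lists stepsA \<and> length s = n \<and>
      (\<forall>k\<le>n. fst (walk_pos s k) \<ge> 0 \<and> snd (walk_pos s k) \<ge> 0) \<and> walk_pos s n = (i, j)}"

lemma walk_count_eq: "walk_count n i j = card (walks n i j)"
  by (simp add: walk_count_def walks_def)

lemma finite_walks [simp]: "finite (walks n i j)"
proof (rule finite_subset)
  show "walks n i j \<subseteq> {s. set s \<subseteq> stepsA \<and> length s = n}" by (auto simp: walks_def)
  show "finite {s. set s \<subseteq> stepsA \<and> length s = n}"
    by (rule finite_lists_length_eq) (simp add: stepsA_def)
qed

lemma walk_pos_snoc:
  "k \<le> length s \<Longrightarrow> walk_pos (s @ [a]) k = walk_pos s k"
  "walk_pos (s @ [a]) (Suc (length s)) = (fst (walk_pos s (length s)) + fst a, snd (walk_pos s (length s)) + snd a)"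
  by (simp_all add: walk_pos_def)

lemma walks_neg: "i < 0 \<or> j < 0 \<Longrightarrow> walks n i j = {}"
  by (auto simp: walks_def)

text \<open>Decomposition by the last step. The prefix is known to stay in the quadrant, and the
  bounds on \<open>i\<close> and \<open>j\<close> add the end point.\<close>

lemma walks_Suc:
  assumes "i \<ge> 0" "j \<ge> 0"
  shows "walks (Suc n) i j = (\<Union>a\<in>stepsA. (\<lambda>s. s @ [a]) ` walks n (i - fst a) (j - snd a))"
proof (intro equalityI subsetI)
  fix s assume s: "s \<in> walks (Suc n) i j"
  then have "s \<noteq> []" by (auto simp: walks_def)
  then obtain u a where u: "s = u @ [a]" by (metis rev_exhaust)
  then have len: "length u = n" and a: "a \<in> stepsA" "u \<in> lists stepsA" using s by (auto simp: walks_def)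
  have "u \<in> walks n (i - fst a) (j - snd a)"
    unfolding walks_def
  proof (intro CollectI conjI allI impI a len)
    fix k assume "k \<le> n"
    then have "walk_pos s k = walk_pos u k" "k \<le> Suc n" using u len by (auto simp: walk_pos_snoc)
    then show "0 \<le> fst (walk_pos u k)" "0 \<le> snd (walk_pos u k)" using s by (auto simp: walks_def)
  next
    have "walk_pos s (Suc n) = (i, j)" using s by (auto simp: walks_def)
    then show "walk_pos u n = (i - fst a, j - snd a)"
      using walk_pos_snoc(2)[of u a] u len by (cases "walk_pos u n") auto
  qed
  then show "s \<in> (\<Union>a\<in>stepsA. (\<lambda>s. s @ [a]) ` walks n (i - fst a) (j - snd a))"
    using a u by blast
next
  fix s assume "s \<in> (\<Union>a\<in>stepsA. (\<lambda>s. s @ [a]) ` walks n (i - fst a) (j - snd a))"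
  then obtain a u where a: "a \<in> stepsA" and u: "u \<in> walks n (i - fst a) (j - snd a)" and s: "s = u @ [a]"
    by blast
  have len: "length u = n" using u by (auto simp: walks_def)
  have e: "walk_pos s (Suc n) = (i, j)" using walk_pos_snoc(2)[of u a] u len s by (auto simp: walks_def)
  show "s \<in> walks (Suc n) i j"
    unfolding walks_def
  proof (intro CollectI conjI allI impI e)
    show "s \<in> lists stepsA" "length s = Suc n" using a u s by (auto simp: walks_def)
    fix k assume k: "k \<le> Suc n"
    have "0 \<le> fst (walk_pos s k) \<and> 0 \<le> snd (walk_pos s k)"
    proof (cases "k = Suc n")
      case True
      then show ?thesis using e assms by simp
    next
      case False
      then have "k \<le> n" using k by simp
      then show ?thesis using u s len by (auto simp: walks_def walk_pos_snoc)
    qed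
    then show "0 \<le> fst (walk_pos s k)" "0 \<le> snd (walk_pos s k)" by auto
  qed
qed

lemma walk_count_neg: "i < 0 \<or> j < 0 \<Longrightarrow> walk_count n i j = 0"
  by (simp add: walk_count_eq walks_neg)

lemma walk_count_0: "walk_count 0 i j = (if i = 0 \<and> j = 0 then 1 else 0)"
proof -
  have "walks 0 i j = (if i = 0 \<and> j = 0 then {[]} else {})"
    by (auto simp: walks_def walk_pos_def)
  then show ?thesis by (simp add: walk_count_eq)
qed

lemma walk_count_Suc:
  assumes "i \<ge> 0" "j \<ge> 0"
  shows "walk_count (Suc n) i j =
    walk_count n (i + 1) (j - 1) + walk_count n (i - 1) (j - 1) + walk_count n (i - 1) (j + 1)"
proof -
  have "card (walks (Suc n) i j) = (\<Sum>a\<in>stepsA. card ((\<lambda>s. s @ [a]) ` walks n (i - fst a) (j - snd a)))"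
    unfolding walks_Suc[OF assms] by (rule card_UN_disjoint) (auto simp: stepsA_def)
  also have "\<dots> = (\<Sum>a\<in>stepsA. walk_count n (i - fst a) (j - snd a))"
    by (rule sum.cong) (auto simp: walk_count_eq card_image inj_on_def)
  also have "\<dots> = walk_count n (i + 1) (j - 1) + walk_count n (i - 1) (j - 1) + walk_count n (i - 1) (j + 1)"
    by (simp add: stepsA_def)
  finally show ?thesis by (simp add: walk_count_eq)
qed

text \<open>The step set is invariant under exchanging the coordinates.\<close>

lemma walk_count_sym: "walk_count n i j = walk_count n j i"
proof (induction n arbitrary: i j)
  case 0
  show ?case by (auto simp: walk_count_0)
next
  case (Suc n)
  show ?case
  proof (cases "i < 0 \<or> j < 0")
    case True
    then show ?thesis by (metis walk_count_neg)
  next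
    case False
    then show ?thesis
      using Suc[of "i+1" "j-1"] Suc[of "i-1" "j-1"] Suc[of "i-1" "j+1"] by (simp add: walk_count_Suc)
  qed
qed

text \<open>Every step changes \<open>i + j\<close> by \<open>0\<close> or \<open>2\<close>.\<close>

lemma walk_count_odd: "odd (i + j) \<Longrightarrow> walk_count n i j = 0"
proof (induction n arbitrary: i j)
  case 0
  then show ?case by (auto simp: walk_count_0)
next
  case (Suc n)
  show ?case
  proof (cases "i < 0 \<or> j < 0")
    case True
    then show ?thesis by (rule walk_count_neg)
  next
    case False
    have "odd ((i+1) + (j-1))" "odd ((i-1) + (j-1))" "odd ((i-1) + (j+1))" using Suc.prems by presburger+
    then show ?thesis using False Suc.IH by (simp add: walk_count_Suc)
  qed
qed

section \<open>Finiteness of the Green function at \<open>t = 1/2\<close>\<close>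

definition walk_weight :: "int \<Rightarrow> int \<Rightarrow> nat \<Rightarrow> real" where
  "walk_weight i j n = real (walk_count n i j) / 2 ^ n"

lemma walk_weight_nonneg: "walk_weight i j n \<ge> 0"
  by (simp add: walk_weight_def)

lemma walk_weight_neg: "i < 0 \<or> j < 0 \<Longrightarrow> walk_weight i j n = 0"
  by (simp add: walk_weight_def walk_count_neg)

lemma walk_weight_Suc:
  assumes "i \<ge> 0" "j \<ge> 0"
  shows "walk_weight i j (Suc n) =
    (walk_weight (i + 1) (j - 1) n + walk_weight (i - 1) (j - 1) n + walk_weight (i - 1) (j + 1) n) / 2"
  by (simp add: walk_weight_def walk_count_Suc[OF assms] add_divide_distrib)

text \<open>Summation by parts with vanishing boundary values: it moves a neighbour step from the
  walk onto the test function.\<close>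

lemma sum_shift_int:
  fixes h :: "int \<Rightarrow> real"
  assumes "s \<ge> 0"
  shows "h 0 = 0 \<Longrightarrow> h (s + 1) = 0 \<Longrightarrow> (\<Sum>x=0..s. h (x + 1)) = (\<Sum>x=0..s. h x)"
    and "h (-1) = 0 \<Longrightarrow> h s = 0 \<Longrightarrow> (\<Sum>x=0..s. h (x - 1)) = (\<Sum>x=0..s. h x)"
proof -
  assume h: "h 0 = 0" "h (s + 1) = 0"
  have "(\<Sum>x=0..s. h (x + 1)) = (\<Sum>x=1..s+1. h x)"
    by (rule sum.reindex_bij_witness[of _ "\<lambda>x. x - 1" "\<lambda>x. x + 1"]) auto
  also have "\<dots> = (\<Sum>x\<in>insert 0 {1..s+1}. h x)" using h by simp
  also have "insert 0 {1..s+1} = insert (s + 1) {0..s}" using assms by auto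
  also have "(\<Sum>x\<in>\<dots>. h x) = (\<Sum>x=0..s. h x)" using h by simp
  finally show "(\<Sum>x=0..s. h (x + 1)) = (\<Sum>x=0..s. h x)" .
next
  assume h: "h (-1) = 0" "h s = 0"
  have "(\<Sum>x=0..s. h (x - 1)) = (\<Sum>x=-1..s-1. h x)"
    by (rule sum.reindex_bij_witness[of _ "\<lambda>x. x + 1" "\<lambda>x. x - 1"]) auto
  also have "\<dots> = (\<Sum>x\<in>insert s {-1..s-1}. h x)" using h by simp
  also have "insert s {-1..s-1} = insert (-1) {0..s}" using assms by auto
  also have "(\<Sum>x\<in>\<dots>. h x) = (\<Sum>x=0..s. h x)" using h by simp
  finally show "(\<Sum>x=0..s. h (x - 1)) = (\<Sum>x=0..s. h x)" .
qed

text \<open>On the antidiagonal \<open>i + j = s\<close> the weighted walk is a simple random walk that is killed outside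
  \<open>{0..s}\<close> and fed from the antidiagonal \<open>s - 2\<close>. Its expected lifetime \<open>(x + 1) (s + 1 - x)\<close> serves as
  Lyapunov function.\<close>

lemma summable_walk_weight_diag: "summable (walk_weight x (int s - x))"
proof (induction s arbitrary: x rule: less_induct)
  case (less s)
  define S where "S = int s"
  have S: "S \<ge> 0" by (simp add: S_def)
  define p where "p n x = walk_weight x (S - x) n" for n x
  \<comment> \<open>The mass at the north-east predecessor of the point, which lies on the
    antidiagonal \<open>S - 2\<close>.\<close>
  define q where "q n x = walk_weight (x - 1) (S - x - 1) n" for n x
  define \<phi> :: "int \<Rightarrow> real" where "\<phi> x = (of_int x + 1) * (of_int S + 1 - of_int x)" for x
  define W where "W n = (\<Sum>x=0..S. \<phi> x * p n x)" for n
  define P where "P n = (\<Sum>x=0..S. p n x)" for n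
  define \<sigma> where "\<sigma> n = (\<Sum>x=0..S. \<phi> x * q n x) / 2" for n
  have p0: "p n x \<ge> 0" and q0: "q n x \<ge> 0" for n x by (simp_all add: p_def q_def walk_weight_nonneg)
  have \<phi>0: "\<phi> x \<ge> 0" if "x \<in> {0..S}" for x using that by (auto simp: \<phi>_def)
  have "summable (\<lambda>n. q n x)" for x
  proof (cases "s \<ge> 2")
    case True
    then have "walk_weight (x - 1) (int (s - 2) - (x - 1)) = (\<lambda>n. q n x)"
      by (auto simp: q_def S_def of_nat_diff algebra_simps)
    then show ?thesis using less[of "s - 2" "x - 1"] True by simp
  next
    case False
    \<comment> \<open>A coordinate sum \<open>S - 2 < 0\<close> forces a negative
      coordinate.\<close>
    then have "q n x = 0" for n unfolding q_def S_def by (rule_tac walk_weight_neg) auto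
    then show ?thesis by simp
  qed
  then have sum\<sigma>: "summable \<sigma>" unfolding \<sigma>_def by (intro summable_divide summable_sum summable_mult)
  \<comment> \<open>Balance of the Lyapunov function: \<open>\<phi>\<close> has second difference
    \<open>-2\<close>, so one step of the walk lowers its mean by the present mass
    \<open>P n\<close>, while feeding adds \<open>\<sigma> n\<close>.\<close>
  have step: "P n = W n - W (Suc n) + \<sigma> n" for n
  proof -
    have pS: "p (Suc n) x = (p n (x + 1) + q n x + p n (x - 1)) / 2" if "x \<in> {0..S}" for x
      using walk_weight_Suc[of x "S - x" n] that by (simp add: p_def q_def algebra_simps)
    have z: "p n (-1) = 0" "p n (S + 1) = 0" by (auto simp: p_def walk_weight_neg)
    \<comment> \<open>Of the two boundary values of each shifted sum, one vanishes through
      \<open>\<phi>\<close> and the other through the walk weight.\<close>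
    have "(\<Sum>x=0..S. \<phi> x * p n (x + 1)) = (\<Sum>x=0..S. \<phi> (x - 1) * p n x)"
      using sum_shift_int(1)[OF S, of "\<lambda>x. \<phi> (x - 1) * p n x"] z by (simp add: \<phi>_def)
    moreover have "(\<Sum>x=0..S. \<phi> x * p n (x - 1)) = (\<Sum>x=0..S. \<phi> (x + 1) * p n x)"
      using sum_shift_int(2)[OF S, of "\<lambda>x. \<phi> (x + 1) * p n x"] z by (simp add: \<phi>_def)
    moreover have "W (Suc n) = (\<Sum>x=0..S. \<phi> x * p n (x + 1)) / 2 + (\<Sum>x=0..S. \<phi> x * p n (x - 1)) / 2 + \<sigma> n"
      unfolding W_def \<sigma>_def sum_divide_distrib sum.distrib[symmetric]
      by (rule sum.cong) (auto simp: pS algebra_simps add_divide_distrib)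
    ultimately have "W (Suc n) - \<sigma> n = (\<Sum>x=0..S. (\<phi> (x - 1) + \<phi> (x + 1)) / 2 * p n x)"
      by (simp add: sum_divide_distrib sum.distrib algebra_simps add_divide_distrib)
    also have "\<dots> = (\<Sum>x=0..S. \<phi> x * p n x - p n x)"
    proof (rule sum.cong)
      fix x
      have "(\<phi> (x - 1) + \<phi> (x + 1)) / 2 = \<phi> x - 1" by (simp add: \<phi>_def field_simps)
      then show "(\<phi> (x - 1) + \<phi> (x + 1)) / 2 * p n x = \<phi> x * p n x - p n x"
        by (simp only: left_diff_distrib mult_1_left)
    qed simp
    also have "\<dots> = W n - P n" by (simp add: W_def P_def sum_subtractf)
    finally show ?thesis by simp
  qed
  have P0: "P n \<ge> 0" for n unfolding P_def by (intro sum_nonneg p0)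
  have W0: "W n \<ge> 0" for n unfolding W_def by (intro sum_nonneg mult_nonneg_nonneg \<phi>0 p0)
  have \<sigma>0: "\<sigma> n \<ge> 0" for n unfolding \<sigma>_def by (intro divide_nonneg_pos sum_nonneg mult_nonneg_nonneg \<phi>0 q0) auto
  \<comment> \<open>The balance telescopes; \<open>W n \<ge> 0\<close> and the summable feed then
    bound the partial sums of \<open>P\<close>.\<close>
  have partial: "sum P {..<n} = W 0 - W n + sum \<sigma> {..<n}" for n
    by (induction n) (auto simp: step)
  have "summable P"
  proof (rule summableI_nonneg_bounded[OF P0])
    fix n
    have "sum \<sigma> {..<n} \<le> suminf \<sigma>" by (rule sum_le_suminf[OF sum\<sigma>]) (auto simp: \<sigma>0)
    then show "sum P {..<n} \<le> W 0 + suminf \<sigma>" using partial[of n] W0[of n] by linarith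
  qed
  then have "summable (\<lambda>n. p n x)" for x
  proof (rule summable_comparison_test_ev[rotated], intro always_eventually allI)
    fix n
    show "norm (p n x) \<le> P n"
    proof (cases "x \<in> {0..S}")
      case True
      then have "p n x \<le> P n" unfolding P_def by (intro member_le_sum p0) auto
      then show ?thesis using p0 by simp
    next
      case False
      then have "p n x = 0" unfolding p_def by (intro walk_weight_neg) auto
      then show ?thesis using P0 by simp
    qed
  qed
  then show ?case by (simp add: p_def S_def)
qed

lemma summable_walk_weight: "summable (walk_weight i j)"
proof (cases "i < 0 \<or> j < 0")
  case True
  then have "walk_weight i j = (\<lambda>n. 0)" by (auto simp: walk_weight_neg)
  then show ?thesis by simp
next
  case False
  then show ?thesis using summable_walk_weight_diag[of i "nat (i + j)"] by simp
qed

definition green :: "int \<Rightarrow> int \<Rightarrow> real" where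
  "green i j = suminf (walk_weight i j)"

lemma green_neg: "i < 0 \<or> j < 0 \<Longrightarrow> green i j = 0"
proof -
  assume "i < 0 \<or> j < 0"
  then have "walk_weight i j = (\<lambda>n. 0)" by (intro ext walk_weight_neg)
  then show ?thesis by (simp add: green_def)
qed

lemma green_sym: "green i j = green j i"
  unfolding green_def walk_weight_def by (subst walk_count_sym) (rule refl)

text \<open>The last-step recursion summed over all lengths; the summand \<open>1\<close> is the
  empty walk.\<close>

lemma green_rec:
  assumes "i \<ge> 0" "j \<ge> 0"
  shows "green i j = (if i = 0 \<and> j = 0 then 1 else 0) +
    (green (i + 1) (j - 1) + green (i - 1) (j - 1) + green (i - 1) (j + 1)) / 2"
proof -
  note s = summable_walk_weight
  have "green i j = (\<Sum>n. walk_weight i j (Suc n)) + walk_weight i j 0"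
    unfolding green_def using suminf_split_head[OF s[of i j]] by simp
  also have "(\<Sum>n. walk_weight i j (Suc n)) =
     (green (i + 1) (j - 1) + green (i - 1) (j - 1) + green (i - 1) (j + 1)) / 2"
    unfolding walk_weight_Suc[OF assms] green_def
    by (simp add: suminf_add s summable_add suminf_divide)
  finally show ?thesis by (simp add: walk_weight_def walk_count_0)
qed

lemma QA_coeff_green: "QA_coeff k = green (int k) 0"
  by (simp add: QA_coeff_def green_def walk_weight_def[abs_def])

lemma QA_coeff_odd: "odd k \<Longrightarrow> QA_coeff k = 0"
  by (simp add: QA_coeff_def walk_count_odd)

section \<open>The kernel method on antidiagonals\<close>

definition diag_coeff :: "nat \<Rightarrow> nat \<Rightarrow> complex fps" where
  "diag_coeff s x = fps_const (of_real (green (int x) (int s - int x)))"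

text \<open>The generating polynomial of the antidiagonal \<open>i + j = s\<close>. Its coefficients
  are constant series because its variable is going to be a power series in
  \<open>x\<close>.\<close>

definition diag_gf :: "complex fps \<Rightarrow> nat \<Rightarrow> complex fps" where
  "diag_gf z s = (\<Sum>x\<le>s. diag_coeff s x * z ^ x)"

lemma diag_coeff_boundary:
  "x > s \<Longrightarrow> diag_coeff s x = 0"
  "diag_coeff s s = fps_const (of_real (QA_coeff s))"
  "diag_coeff s 0 = fps_const (of_real (QA_coeff s))"
  by (simp_all add: diag_coeff_def green_neg QA_coeff_green green_sym[of 0])

text \<open>This is \<open>green_rec\<close> on a positive antidiagonal, where the empty walk does
  not occur. The cases \<open>x = 0\<close> encode the value \<open>0\<close> outside the quadrant,
  which truncated subtraction would miss.\<close>

lemma diag_coeff_rec: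
  assumes "x \<le> s + 2"
  shows "2 * diag_coeff (s + 2) x = diag_coeff (s + 2) (Suc x) +
    (if x = 0 then 0 else diag_coeff (s + 2) (x - 1)) + (if x = 0 then 0 else diag_coeff s (x - 1))"
proof -
  define I where "I = int x"
  define J where "J = int (s + 2) - int x"
  have "2 * green I J = green (I + 1) (J - 1) + green (I - 1) (J + 1) + green (I - 1) (J - 1)"
    using green_rec[of I J] assms by (simp add: I_def J_def)
  moreover have "green (I + 1) (J - 1) = green (int (Suc x)) (int (s + 2) - int (Suc x))"
    by (simp add: I_def J_def algebra_simps)
  moreover have "green (I - 1) (J + 1) = (if x = 0 then 0 else green (int (x - 1)) (int (s + 2) - int (x - 1)))"
    by (simp add: I_def J_def algebra_simps green_neg of_nat_diff)
  moreover have "green (I - 1) (J - 1) = (if x = 0 then 0 else green (int (x - 1)) (int s - int (x - 1)))"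
    by (simp add: I_def J_def algebra_simps green_neg of_nat_diff)
  ultimately have "2 * green (int x) (int (s + 2) - int x) = green (int (Suc x)) (int (s + 2) - int (Suc x)) +
     (if x = 0 then 0 else green (int (x - 1)) (int (s + 2) - int (x - 1))) +
     (if x = 0 then 0 else green (int (x - 1)) (int s - int (x - 1)))"
    by (simp only: I_def J_def)
  then have "fps_const (complex_of_real (2 * green (int x) (int (s + 2) - int x))) =
     fps_const (of_real (green (int (Suc x)) (int (s + 2) - int (Suc x)) +
     (if x = 0 then 0 else green (int (x - 1)) (int (s + 2) - int (x - 1))) +
     (if x = 0 then 0 else green (int (x - 1)) (int s - int (x - 1)))))"
    by (simp only:)
  then show ?thesis
    unfolding diag_coeff_def
    by (simp add: numeral_fps_const flip: fps_const_add)
qed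

lemma diag_gf_0: "diag_gf z 0 = 1"
  using green_rec[of 0 0] by (simp add: diag_gf_def diag_coeff_def green_neg)

text \<open>Multiplying \<open>diag_coeff_rec\<close> by \<open>z ^ Suc x\<close> and summing yields
  the kernel \<open>(z - 1)^2\<close>. The two ends of the antidiagonal contribute the same boundary
  value \<open>QA_coeff (s + 2)\<close>, by symmetry.\<close>

lemma diag_gf_rec:
  "(z - 1) ^ 2 * diag_gf z (s + 2) = fps_const (of_real (QA_coeff (s + 2))) * (1 + z ^ (s + 4)) - z ^ 2 * diag_gf z s"
proof -
  let ?S = "s + 2" and ?a = "fps_const (complex_of_real (QA_coeff (s + 2)))"
  let ?R = "diag_gf z (s + 2)"
  have S: "s + 2 = Suc (s + 1)" by simp
  have "(\<Sum>x\<le>Suc ?S. diag_coeff ?S x * z ^ x) = ?R"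
    by (simp add: diag_gf_def diag_coeff_boundary)
  then have 1: "(\<Sum>x\<le>?S. diag_coeff ?S (Suc x) * z ^ Suc x) = ?R - ?a"
    unfolding sum.atMost_Suc_shift by (simp add: diag_coeff_boundary algebra_simps)
  have "(\<Sum>x\<le>?S. (if x = 0 then 0 else diag_coeff ?S (x - 1)) * z ^ Suc x) = z ^ 2 * (\<Sum>x\<le>s+1. diag_coeff ?S x * z ^ x)"
    unfolding S sum.atMost_Suc_shift by (simp add: sum_distrib_left power2_eq_square mult_ac del: sum.atMost_Suc)
  also have "(\<Sum>x\<le>s+1. diag_coeff ?S x * z ^ x) = ?R - ?a * z ^ ?S"
    using diag_coeff_boundary(2)[of ?S] by (simp add: diag_gf_def)
  finally have 2: "(\<Sum>x\<le>?S. (if x = 0 then 0 else diag_coeff ?S (x - 1)) * z ^ Suc x) = z ^ 2 * (?R - ?a * z ^ ?S)" .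
  have "(\<Sum>x\<le>?S. (if x = 0 then 0 else diag_coeff s (x - 1)) * z ^ Suc x) = z ^ 2 * (\<Sum>x\<le>s+1. diag_coeff s x * z ^ x)"
    unfolding S sum.atMost_Suc_shift by (simp add: sum_distrib_left power2_eq_square mult_ac del: sum.atMost_Suc)
  also have "(\<Sum>x\<le>s+1. diag_coeff s x * z ^ x) = diag_gf z s"
    by (simp add: diag_gf_def diag_coeff_boundary)
  finally have 3: "(\<Sum>x\<le>?S. (if x = 0 then 0 else diag_coeff s (x - 1)) * z ^ Suc x) = z ^ 2 * diag_gf z s" .
  have "2 * z * ?R = (\<Sum>x\<le>?S. 2 * diag_coeff ?S x * z ^ Suc x)"
    unfolding diag_gf_def sum_distrib_left by (rule sum.cong) (simp_all add: mult_ac)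
  also have "\<dots> = (\<Sum>x\<le>?S. diag_coeff ?S (Suc x) * z ^ Suc x +
     (if x = 0 then 0 else diag_coeff ?S (x - 1)) * z ^ Suc x + (if x = 0 then 0 else diag_coeff s (x - 1)) * z ^ Suc x)"
    by (rule sum.cong) (simp_all only: diag_coeff_rec ring_distribs atMost_iff)
  also have "\<dots> = (?R - ?a) + z ^ 2 * (?R - ?a * z ^ ?S) + z ^ 2 * diag_gf z s"
    unfolding sum.distrib 1 2 3 ..
  finally have "2 * z * ?R = (?R - ?a) + z ^ 2 * (?R - ?a * z ^ ?S) + z ^ 2 * diag_gf z s" .
  moreover have "z ^ (s + 4) = z ^ 2 * z ^ ?S" by (simp add: power_add eval_nat_numeral)
  ultimately show ?thesis by (simp add: algebra_simps power2_eq_square)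
qed

lemma QA_coeff_0: "QA_coeff 0 = 1"
  using green_rec[of 0 0] by (simp add: QA_coeff_green green_neg)

definition shifted_Q :: "complex fps" where
  "shifted_Q = fps_X ^ 2 * QA_half"

lemma shifted_Q_nth: "fps_nth shifted_Q n = (if n < 2 then 0 else of_real (QA_coeff (n - 2)))"
  by (simp add: shifted_Q_def fps_X_power_mult_nth QA_half_def)

text \<open>At \<open>z = 1 - \<i> x\<close> the kernel is \<open>- x^2\<close>, and
  \<open>\<mu> z = x\<close>. Multiplied by \<open>\<mu>^(s+4)\<close>, the recurrence of
  \<open>diag_gf_rec\<close> expresses \<open>x^2 \<mu>^(s+2)\<close> times the polynomial of level
  \<open>s\<close> by a boundary term and the same expression at level \<open>s + 2\<close>;
  iterating over even \<open>s\<close> leaves the last summand as remainder.\<close>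

lemma kernel_iteration:
  "2 * fps_X * moebius = (\<Sum>m\<le>M. fps_const (of_real (QA_coeff (2 * m))) * (fps_X ^ (2 * m + 2) + moebius ^ (2 * m + 2)))
     + fps_X ^ 2 * moebius ^ (2 * M + 2) * diag_gf (1 - fps_const \<i> * fps_X) (2 * M)"
proof -
  define z :: "complex fps" where "z = 1 - fps_const \<i> * fps_X"
  have "fps_const \<i> * fps_const \<i> = (-1 :: complex fps)" by (simp flip: fps_const_neg)
  then have "(fps_const \<i> * fps_X) * (fps_const \<i> * fps_X) = (- (fps_X ^ 2) :: complex fps)"
    by (metis (no_types, lifting) mult.assoc mult.left_commute mult_minus1 power2_eq_square)
  then have z2: "(z - 1) ^ 2 = - (fps_X ^ 2)" by (simp add: z_def power2_eq_square)
  have Yz: "moebius * z = fps_X" using moebius_eq by (simp add: z_def)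
  show ?thesis
    unfolding z_def[symmetric]
  proof (induction M)
    case 0
    have "fps_X ^ 2 + moebius ^ 2 + fps_X ^ 2 * moebius ^ 2 = moebius ^ 2 * (z ^ 2 + 1 - (z - 1) ^ 2)"
      unfolding z2 by (simp add: Yz[symmetric] power_mult_distrib algebra_simps)
    also have "\<dots> = 2 * (moebius * z) * moebius" by (simp add: power2_eq_square algebra_simps)
    finally have "2 * fps_X * moebius = (fps_X ^ 2 + moebius ^ 2) + fps_X ^ 2 * moebius ^ 2" by (simp only: Yz)
    then show ?case by (simp add: diag_gf_0 QA_coeff_0 power2_eq_square)
  next
    case (Suc M)
    let ?a = "fps_const (complex_of_real (QA_coeff (2 * M + 2)))"
    have r: "z ^ 2 * diag_gf z (2 * M) = ?a * (1 + z ^ (2 * M + 4)) + fps_X ^ 2 * diag_gf z (2 * M + 2)"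
      using diag_gf_rec[of z "2 * M"] unfolding z2 by (simp add: algebra_simps)
    have "fps_X ^ 2 * moebius ^ (2 * M + 2) * diag_gf z (2 * M) = moebius ^ (2 * M + 4) * (z ^ 2 * diag_gf z (2 * M))"
      by (simp add: Yz[symmetric] power_mult_distrib power_add eval_nat_numeral mult_ac)
    also have "\<dots> = ?a * (moebius ^ (2 * M + 4) + (moebius * z) ^ (2 * M + 4)) + moebius ^ (2 * M + 4) * (fps_X ^ 2 * diag_gf z (2 * M + 2))"
      unfolding r by (simp only: power_mult_distrib ring_distribs mult_ac mult_1_right mult_1_left)
    finally have "fps_X ^ 2 * moebius ^ (2 * M + 2) * diag_gf z (2 * M) =
      ?a * (fps_X ^ (2 * M + 4) + moebius ^ (2 * M + 4)) + fps_X ^ 2 * moebius ^ (2 * M + 4) * diag_gf z (2 * M + 2)"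
      by (simp only: Yz mult_ac add_ac)
    moreover have "2 * Suc M + 2 = 2 * M + 4" "2 * Suc M = 2 * M + 2" by simp_all
    ultimately show ?case using Suc by (simp only: sum.atMost_Suc add.assoc)
  qed
qed

text \<open>The limit of \<open>kernel_iteration\<close>: the remainder has order at least
  \<open>2 * M + 4\<close> in \<open>x\<close>, so no fixed coefficient sees it once
  \<open>M\<close> is large.\<close>

lemma shifted_Q_functional_equation:
  "shifted_Q + (shifted_Q oo moebius) = 2 * fps_X * moebius"
proof (rule fps_ext)
  fix n
  \<comment> \<open>A truncation that agrees with \<open>shifted_Q\<close> up to degree
    \<open>n\<close>, the odd coefficients being zero. Composition with a series without constant
    term preserves this agreement.\<close>
  define F where "F = (\<Sum>m\<le>n. fps_const (complex_of_real (QA_coeff (2 * m))) * fps_X ^ (2 * m + 2))"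
  have F: "fps_nth shifted_Q i = fps_nth F i" if "i \<le> n" for i
  proof -
    have "fps_nth F i = (\<Sum>m\<le>n. if i = 2 * m + 2 then complex_of_real (QA_coeff (2 * m)) else 0)"
      unfolding F_def fps_sum_nth by (rule sum.cong) auto
    also have "\<dots> = fps_nth shifted_Q i"
    proof (cases "even i \<and> i \<ge> 2")
      case True
      then obtain k where "i = 2 * k" by blast
      then obtain m where m: "i = 2 * m + 2" using True by (cases k) auto
      have "(\<Sum>m'\<le>n. if i = 2 * m' + 2 then complex_of_real (QA_coeff (2 * m')) else 0)
          = (\<Sum>m'\<le>n. if m = m' then complex_of_real (QA_coeff (2 * m')) else 0)"
        by (rule sum.cong) (auto simp: m)
      also have "\<dots> = complex_of_real (QA_coeff (2 * m))" using that m by simp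
      finally show ?thesis using m by (simp add: shifted_Q_nth)
    next
      case False
      then have "fps_nth shifted_Q i = 0" by (auto simp: shifted_Q_nth QA_coeff_odd)
      moreover have "(\<Sum>m'\<le>n. if i = 2 * m' + 2 then complex_of_real (QA_coeff (2 * m')) else 0) = 0"
        using False by (intro sum.neutral) auto
      ultimately show ?thesis by simp
    qed
    finally show ?thesis ..
  qed
  define V :: "complex fps" where "V = inverse (1 - fps_const \<i> * fps_X)"
  have Y: "moebius = fps_X * V" unfolding moebius_def V_def by (subst fps_divide_unit) auto
  have rest: "fps_nth (fps_X ^ 2 * moebius ^ (2 * n + 2) * G) n = 0" for G
    by (simp add: Y power_mult_distrib fps_X_power_mult_nth mult.assoc del: power_Suc) arith
  have FY: "F oo moebius = (\<Sum>m\<le>n. fps_const (complex_of_real (QA_coeff (2 * m))) * moebius ^ (2 * m + 2))"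
    unfolding F_def fps_compose_sum_distrib
    by (rule sum.cong) (simp_all add: fps_compose_mult_distrib fps_compose_power[symmetric] del: power_Suc)
  have "fps_nth (shifted_Q + (shifted_Q oo moebius)) n = fps_nth (F + (F oo moebius)) n"
    by (simp add: fps_compose_nth F)
  also have "\<dots> = fps_nth (\<Sum>m\<le>n. fps_const (of_real (QA_coeff (2 * m))) * (fps_X ^ (2 * m + 2) + moebius ^ (2 * m + 2))) n"
    unfolding FY unfolding F_def sum.distrib[symmetric] by (simp only: ring_distribs)
  also have "\<dots> = fps_nth (2 * fps_X * moebius) n"
    unfolding kernel_iteration[of n] using rest by simp
  finally show "fps_nth (shifted_Q + (shifted_Q oo moebius)) n = fps_nth (2 * fps_X * moebius) n" .
qed

section \<open>Closed form and recurrence of the coefficients\<close>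

lemma QA_coeff_bernoulli:
  "complex_of_real (QA_coeff k) = - 4 * (2 ^ (k + 2) - 1) * \<i> ^ (k + 2) * of_real (bernoulli (k + 2)) / of_nat (k + 2)"
proof -
  have "complex_of_real (QA_coeff k) = fact (Suc k) * fps_nth (borel_fps shifted_Q) (Suc k)"
    by (simp add: shifted_Q_nth del: fact_Suc)
  also have "\<dots> = fact (Suc k) * (- 4 * (2 ^ (k + 2) - 1) * \<i> ^ (k + 2) * of_real (bernoulli (k + 2)) / fact (k + 2))"
    by (subst tan_nth_bernoulli[OF shifted_Q_functional_equation refl]) (rule refl)
  also have "fact (k + 2) = (of_nat (k + 2) * fact (Suc k) :: complex)"
    by simp
  finally show ?thesis by (simp add: divide_simps del: fact_Suc)
qed

lemma QA_half_eq:
  "QA_half = Abs_fps (\<lambda>k. if even k then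
            complex_of_real (2 * (2 ^ (k + 2) - 1) * (-1) ^ (k div 2) / real (k div 2 + 1) * bernoulli (k + 2))
          else 0)"
proof (rule fps_ext)
  fix k
  have "complex_of_real (QA_coeff k) =
    complex_of_real (2 * (2 ^ (k + 2) - 1) * (-1) ^ (k div 2) / real (k div 2 + 1) * bernoulli (k + 2))"
    if "even k"
  proof -
    obtain j where k: "k = 2 * j" using \<open>even k\<close> by (elim evenE)
    have i: "\<i> ^ (k + 2) = - ((-1) ^ j)" by (simp add: k power_mult)
    have n: "(of_nat (k + 2) :: complex) = 2 * of_nat (j + 1)" by (simp add: k)
    have "complex_of_real (2 * (2 ^ (k + 2) - 1) * (-1) ^ (k div 2) / real (k div 2 + 1) * bernoulli (k + 2))
      = 2 * (2 ^ (k + 2) - 1) * (-1) ^ j / of_nat (j + 1) * of_real (bernoulli (k + 2))"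
      by (simp add: k)
    moreover have "- 4 * A * - s * B / (2 * n) = 2 * A * s / n * B" for A s B n :: complex
      by simp
    ultimately show ?thesis unfolding QA_coeff_bernoulli i n by (simp only:)
  qed
  then show "fps_nth QA_half k = fps_nth (Abs_fps (\<lambda>k. if even k then
      complex_of_real (2 * (2 ^ (k + 2) - 1) * (-1) ^ (k div 2) / real (k div 2 + 1) * bernoulli (k + 2)) else 0)) k"
    by (auto simp: QA_half_def QA_coeff_odd)
qed

text \<open>The Borel transform \<open>T\<close> is the exponential generating function of the
  shifted sequence, and the recurrence compares coefficients in \<open>2 T'' = T T'\<close>.\<close>

lemma QA_coeff_recurrence:
  "2 * QA_coeff (n + 1) = (\<Sum>l=1..n. real (n choose l) * QA_coeff (l - 1) * QA_coeff (n - l))"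
proof -
  define T where "T = borel_fps shifted_Q"
  have T0: "fps_nth T 0 = 0" by (simp add: T_def shifted_Q_nth)
  have TS: "fps_nth T (Suc k) = of_real (QA_coeff k) / fact (Suc k)" for k
    by (simp add: T_def shifted_Q_nth)
  have "2 * complex_of_real (QA_coeff (n + 1)) = fact n * fps_nth (2 * fps_deriv (fps_deriv T)) n"
  proof -
    have "fact (Suc (Suc n)) = (of_nat (Suc (Suc n)) * of_nat (Suc n) * fact n :: complex)"
      by (simp only: fact_Suc mult.assoc of_nat_mult)
    then show ?thesis by (simp add: TS divide_simps del: fact_Suc of_nat_Suc)
  qed
  also have "\<dots> = fact n * fps_nth (T * fps_deriv T) n"
    using tan_deriv_deriv[OF shifted_Q_functional_equation T_def] by simp
  also have "\<dots> = (\<Sum>l=0..n. fact n * (fps_nth T l * (of_nat (Suc (n - l)) * fps_nth T (Suc (n - l)))))"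
    by (simp add: fps_mult_nth sum_distrib_left del: of_nat_Suc)
  \<comment> \<open>The term \<open>l = 0\<close> drops out because \<open>T\<close> has no constant
    term.\<close>
  also have "\<dots> = (\<Sum>l=1..n. fact n * (fps_nth T l * (of_nat (Suc (n - l)) * fps_nth T (Suc (n - l)))))"
    by (rule sum.mono_neutral_right) (auto simp: T0 not_less_eq_eq le_Suc_eq)
  also have "\<dots> = (\<Sum>l=1..n. of_real (real (n choose l) * QA_coeff (l - 1) * QA_coeff (n - l)))"
  proof (rule sum.cong)
    fix l assume l: "l \<in> {1..n}"
    then have "fps_nth T l = of_real (QA_coeff (l - 1)) / fact l" using TS[of "l - 1"] by simp
    moreover have "of_nat (Suc (n - l)) * fps_nth T (Suc (n - l)) = of_real (QA_coeff (n - l)) / fact (n - l)"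
      by (simp add: TS divide_simps del: of_nat_Suc)
    ultimately show "fact n * (fps_nth T l * (of_nat (Suc (n - l)) * fps_nth T (Suc (n - l))))
      = complex_of_real (real (n choose l) * QA_coeff (l - 1) * QA_coeff (n - l))"
      using l by (simp add: binomial_fact)
  qed simp
  also have "\<dots> = complex_of_real (\<Sum>l=1..n. real (n choose l) * QA_coeff (l - 1) * QA_coeff (n - l))"
    by simp
  finally have "complex_of_real (2 * QA_coeff (n + 1))
    = complex_of_real (\<Sum>l=1..n. real (n choose l) * QA_coeff (l - 1) * QA_coeff (n - l))"
    by (simp only: of_real_mult of_real_numeral)
  then show ?thesis by (simp only: of_real_eq_iff)
qed

section \<open>Algebraic relations between solutions of difference equations\<close>

text \<open>The monomials of degree at most \<open>d\<close> in the variables \<open>0..m\<close>,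
  coded as multisets of indices: the degree is \<open>size\<close>, and splitting off a variable is
  multiset difference.\<close>

definition msets :: "nat \<Rightarrow> nat \<Rightarrow> nat multiset set" where
  "msets m d = {M. set_mset M \<subseteq> {..m} \<and> size M \<le> d}"

lemma finite_msets [simp, intro]: "finite (msets m d)"
proof (induction d)
  case 0
  have "msets m 0 = {{#}}" by (auto simp: msets_def)
  then show ?case by simp
next
  case (Suc d)
  have "msets m (Suc d) \<subseteq> insert {#} ((\<lambda>(a, M). add_mset a M) ` ({..m} \<times> msets m d))"
  proof
    fix M assume M: "M \<in> msets m (Suc d)"
    show "M \<in> insert {#} ((\<lambda>(a, M). add_mset a M) ` ({..m} \<times> msets m d))"
    proof (cases M)
      case (add a N)
      then have "(a, N) \<in> {..m} \<times> msets m d" using M by (auto simp: msets_def)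
      then show ?thesis using add by force
    qed simp
  qed
  then show ?case using Suc by (meson finite_SigmaI finite_atMost finite_imageI finite_insert finite_subset)
qed

lemma msets_subset: "M \<in> msets m d \<Longrightarrow> N \<subseteq># M \<Longrightarrow> N \<in> msets m d"
  using set_mset_mono[of N M] size_mset_mono[of N M] by (auto simp: msets_def)

definition monom_val :: "(nat \<Rightarrow> 'a::comm_monoid_mult) \<Rightarrow> nat multiset \<Rightarrow> 'a" where
  "monom_val v M = (\<Prod>i\<in>#M. v i)"

lemma monom_val_simps [simp]:
  "monom_val v {#} = 1" "monom_val v (add_mset i M) = v i * monom_val v M"
  by (simp_all add: monom_val_def)

text \<open>The set \<open>K\<close> is a subfield of the ambient field, mapped into itself by the
  ring endomorphism \<open>\<tau>\<close>. Below, \<open>K\<close> consists of the meromorphic germs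
  among the formal Laurent series and \<open>\<tau>\<close> substitutes the Moebius map.
  Characteristic zero keeps multiplicities of variables nonzero.\<close>

locale difference_field =
  fixes K :: "'a::{field,ring_char_0} set" and \<tau> :: "'a \<Rightarrow> 'a"
  assumes K_1: "1 \<in> K"
    and K_add: "a \<in> K \<Longrightarrow> b \<in> K \<Longrightarrow> a + b \<in> K"
    and K_uminus: "a \<in> K \<Longrightarrow> - a \<in> K"
    and K_mult: "a \<in> K \<Longrightarrow> b \<in> K \<Longrightarrow> a * b \<in> K"
    and K_inverse: "a \<in> K \<Longrightarrow> inverse a \<in> K"
    and \<tau>_1: "\<tau> 1 = 1"
    and \<tau>_add: "\<tau> (a + b) = \<tau> a + \<tau> b"
    and \<tau>_mult: "\<tau> (a * b) = \<tau> a * \<tau> b"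
    and \<tau>_K: "a \<in> K \<Longrightarrow> \<tau> a \<in> K"
begin

lemma K_0: "0 \<in> K"
  using K_add[OF K_1 K_uminus[OF K_1]] by simp

lemma K_diff: "a \<in> K \<Longrightarrow> b \<in> K \<Longrightarrow> a - b \<in> K"
  using K_add[of a "-b"] K_uminus by simp

lemma K_sum: "(\<And>x. x \<in> A \<Longrightarrow> c x \<in> K) \<Longrightarrow> sum c A \<in> K"
  by (induction A rule: infinite_finite_induct) (auto intro: K_0 K_add)

lemma K_power: "a \<in> K \<Longrightarrow> a ^ n \<in> K"
  by (induction n) (auto intro: K_1 K_mult)

lemma K_of_nat: "of_nat n \<in> K"
  by (induction n) (auto intro: K_0 K_1 K_add)

lemma \<tau>_0 [simp]: "\<tau> 0 = 0"
  using \<tau>_add[of 0 0] by simp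

lemma \<tau>_of_nat: "\<tau> (of_nat n) = of_nat n"
  by (induction n) (auto simp: \<tau>_add \<tau>_1)

lemma \<tau>_sum: "\<tau> (sum c A) = (\<Sum>x\<in>A. \<tau> (c x))"
  by (induction A rule: infinite_finite_induct) (auto simp: \<tau>_add)

text \<open>The two top layers (degrees \<open>size M\<close> and \<open>size M - 1\<close>) of the expansion of
  \<open>\<tau> (\<Prod>i\<in>#M. f i) = (\<Prod>i\<in>#M. r i - f i)\<close>; nothing is recorded about the lower ones.\<close>

definition \<tau>_expansion :: "(nat \<Rightarrow> 'a) \<Rightarrow> (nat \<Rightarrow> 'a) \<Rightarrow> nat multiset \<Rightarrow> (nat multiset \<Rightarrow> 'a) \<Rightarrow> bool" where
  "\<tau>_expansion f r M t \<longleftrightarrow> (\<forall>N. t N \<in> K) \<and> (\<forall>N. t N \<noteq> 0 \<longrightarrow> N \<subseteq># M) \<and> t M = (-1) ^ size M \<and>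
    (\<forall>i\<in>#M. t (M - {#i#}) = (-1) ^ (size M - 1) * of_nat (count M i) * r i) \<and>
    \<tau> (monom_val f M) = (\<Sum>N | N \<subseteq># M. t N * monom_val f N)"

text \<open>Induction on the factors. The count in the second layer is the number of equal factors
  from which \<open>r i\<close> can be taken instead of \<open>- f i\<close>.\<close>

lemma ex_\<tau>_expansion:
  assumes f: "\<And>i. \<tau> (f i) = r i - f i" and r: "\<And>i. r i \<in> K"
  shows "\<exists>t. \<tau>_expansion f r M t"
  unfolding \<tau>_expansion_def
proof (induction M)
  case empty
  show ?case by (rule exI[of _ "\<lambda>N. if N = {#} then 1 else 0"]) (auto intro: K_0 K_1 simp: \<tau>_1)
next
  case (add j M)
  then obtain t where "\<tau>_expansion f r M t" by (auto simp: \<tau>_expansion_def)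
  then have tK: "\<And>N. t N \<in> K" and t0: "\<And>N. \<not> N \<subseteq># M \<Longrightarrow> t N = 0"
    and tM: "t M = (-1) ^ size M"
    and tM1: "\<And>i. i \<in># M \<Longrightarrow> t (M - {#i#}) = (-1) ^ (size M - 1) * of_nat (count M i) * r i"
    and tsum: "\<tau> (monom_val f M) = (\<Sum>N | N \<subseteq># M. t N * monom_val f N)"
    unfolding \<tau>_expansion_def by blast+
  \<comment> \<open>The coefficient rule for multiplication by \<open>r j - f j\<close>.\<close>
  define t' where "t' N = r j * t N - (if j \<in># N then t (N - {#j#}) else 0)" for N
  have fin: "finite {N. N \<subseteq># M'}" for M' :: "nat multiset"
    using finite_msets[of "Max (insert 0 (set_mset M'))" "size M'"]
  proof (rule finite_subset[rotated], safe)
    fix N assume "N \<subseteq># M'"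
    moreover have "M' \<in> msets (Max (insert 0 (set_mset M'))) (size M')"
      by (auto simp: msets_def)
    ultimately show "N \<in> msets (Max (insert 0 (set_mset M'))) (size M')"
      using msets_subset by blast
  qed
  show ?case
  proof (intro exI conjI allI impI ballI)
    fix N
    show "t' N \<in> K" unfolding t'_def by (auto intro!: K_diff K_mult r tK K_0)
    assume "t' N \<noteq> 0"
    then have "t N \<noteq> 0 \<or> (j \<in># N \<and> t (N - {#j#}) \<noteq> 0)" by (auto simp: t'_def split: if_splits)
    then show "N \<subseteq># add_mset j M"
    proof
      assume "t N \<noteq> 0" then have "N \<subseteq># M" using t0 by blast
      then show ?thesis by (metis add_mset_remove_trivial diff_subset_eq_self subset_mset.order_trans)
    next
      assume a: "j \<in># N \<and> t (N - {#j#}) \<noteq> 0" then have "N - {#j#} \<subseteq># M" using t0 by blast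
      then show ?thesis by (simp add: subset_eq_diff_conv)
    qed
  next
    have "\<not> add_mset j M \<subseteq># M" using mset_subset_eq_insertD[of j M M] by auto
    then have "t (add_mset j M) = 0" by (rule t0)
    then show "t' (add_mset j M) = (-1) ^ size (add_mset j M)" by (simp add: t'_def tM)
  next
    fix i assume i: "i \<in># add_mset j M"
    show "t' (add_mset j M - {#i#}) = (-1) ^ (size (add_mset j M) - 1) * of_nat (count (add_mset j M) i) * r i"
    proof (cases "i = j")
      case True
      show ?thesis
      proof (cases "j \<in># M")
        case T: True
        then have "size M = Suc (size M - 1)" by (cases "size M") auto
        then have s: "(-1 :: 'a) ^ size M = - ((-1) ^ (size M - 1))" by (metis power_Suc mult_minus1)
        show ?thesis using T True by (simp add: t'_def tM tM1 s algebra_simps)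
      next
        case F: False
        then have "count M j = 0" by (simp add: count_eq_zero_iff)
        then show ?thesis using True F by (simp add: t'_def tM del: count_eq_zero_iff)
      qed
    next
      case False
      then have iM: "i \<in># M" using i by auto
      then have "size M = Suc (size M - 1)" by (cases "size M") auto
      then have s: "(-1 :: 'a) ^ size M = - ((-1) ^ (size M - 1))" by (metis power_Suc mult_minus1)
      have eq: "add_mset j M - {#i#} = add_mset j (M - {#i#})" using False by simp
      have "\<not> add_mset j (M - {#i#}) \<subseteq># M"
      proof
        assume "add_mset j (M - {#i#}) \<subseteq># M"
        then have "count (add_mset j (M - {#i#})) j \<le> count M j" by (rule mset_subset_eq_count)
        then show False using False by simp
      qed
      then have "t (add_mset j (M - {#i#})) = 0" by (rule t0)
      then show ?thesis using False iM unfolding eq by (simp add: t'_def tM1 s)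
    qed
  next
    let ?A = "{N. N \<subseteq># add_mset j M}"
    have sub: "{N. N \<subseteq># M} \<subseteq> ?A"
      by (auto intro: subset_mset.order_trans)
    have 1: "(\<Sum>N\<in>?A. t N * monom_val f N) = \<tau> (monom_val f M)"
      unfolding tsum by (rule sum.mono_neutral_right) (use fin sub t0 in auto)
    have "(\<Sum>N\<in>?A. (if j \<in># N then t (N - {#j#}) else 0) * monom_val f N)
        = (\<Sum>N\<in>{N\<in>?A. j \<in># N}. t (N - {#j#}) * monom_val f N)"
      by (rule sum.mono_neutral_cong_right) (use fin in auto)
    also have "\<dots> = (\<Sum>N | N \<subseteq># M. t N * monom_val f (add_mset j N))"
      by (rule sum.reindex_bij_witness[of _ "add_mset j" "\<lambda>N. N - {#j#}"])
         (auto simp: subset_eq_diff_conv)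
    also have "\<dots> = f j * \<tau> (monom_val f M)"
      unfolding tsum by (simp add: sum_distrib_left mult_ac)
    finally have 2: "(\<Sum>N\<in>?A. (if j \<in># N then t (N - {#j#}) else 0) * monom_val f N) = f j * \<tau> (monom_val f M)" .
    have "(\<Sum>N\<in>?A. t' N * monom_val f N) = r j * (\<Sum>N\<in>?A. t N * monom_val f N)
       - (\<Sum>N\<in>?A. (if j \<in># N then t (N - {#j#}) else 0) * monom_val f N)"
      by (simp add: t'_def sum_subtractf sum_distrib_left algebra_simps)
    also have "\<dots> = \<tau> (monom_val f (add_mset j M))"
      unfolding 1 2 by (simp add: \<tau>_mult f algebra_simps)
    finally show "\<tau> (monom_val f (add_mset j M)) = (\<Sum>N\<in>?A. t' N * monom_val f N)" ..
  qed
qed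

text \<open>By contradiction: if no such linear relation exists, induction on the degree shows that
  every polynomial relation is trivial.\<close>

lemma algebraic_dependence_imp_linear:
  assumes f: "\<And>i. \<tau> (f i) = r i - f i" and r: "\<And>i. r i \<in> K"
    and anti: "\<And>h. \<tau> h = - h \<Longrightarrow> h = 0"
    and cK: "\<And>M. c M \<in> K" and c0: "\<exists>M\<in>msets m d. c M \<noteq> 0"
    and csum: "(\<Sum>M\<in>msets m d. c M * monom_val f M) = 0"
  shows "\<exists>l. (\<forall>i. l i \<in> K \<and> \<tau> (l i) = l i) \<and> (\<exists>i\<le>m. l i \<noteq> 0) \<and> (\<Sum>i\<le>m. l i * f i) \<in> K"
proof (rule ccontr)
  assume no_lin: "\<not> ?thesis"
  have "\<forall>M\<in>msets m d. c M = 0"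
    if "\<And>M. c M \<in> K" "(\<Sum>M\<in>msets m d. c M * monom_val f M) = 0" for c d
    using that
  proof (induction d arbitrary: c)
    case 0
    have "msets m 0 = {{#}}" by (auto simp: msets_def)
    then show ?case using 0 by simp
  next
    case (Suc d)
    define top where "top = {M. set_mset M \<subseteq> {..m} \<and> size M = Suc d}"
    have top_sub: "top \<subseteq> msets m (Suc d)" by (auto simp: top_def msets_def)
    have split: "msets m (Suc d) = msets m d \<union> top" "msets m d \<inter> top = {}"
      by (auto simp: top_def msets_def)
    have fin_top: "finite top" using top_sub finite_subset by blast
    define rel where "rel c \<longleftrightarrow> (\<forall>M. c M \<in> K) \<and> (\<Sum>M\<in>msets m (Suc d). c M * monom_val f M) = 0" for c
    define supp where "supp c = {M\<in>top. c M \<noteq> 0}" for c :: "nat multiset \<Rightarrow> 'a"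
    have fin_supp: "finite (supp c)" for c using fin_top by (simp add: supp_def)
    \<comment> \<open>A relation without terms of top degree falls under the induction
      hypothesis.\<close>
    have lower: "\<forall>M\<in>msets m (Suc d). c M = 0" if c: "rel c" "supp c = {}" for c
    proof -
      have z: "c M = 0" if "M \<in> top" for M using c that by (auto simp: supp_def)
      have "(\<Sum>M\<in>msets m d. c M * monom_val f M) = (\<Sum>M\<in>msets m (Suc d). c M * monom_val f M)"
        by (rule sum.mono_neutral_left) (use split z fin_top in auto)
      then have "(\<Sum>M\<in>msets m d. c M * monom_val f M) = 0"
        using c by (simp add: rel_def)
      then have "\<forall>M\<in>msets m d. c M = 0" using Suc.IH[of c] c by (auto simp: rel_def)
      then show ?thesis using split z by auto
    qed
    have "supp c = {}"
    proof (rule ccontr)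
      assume "supp c \<noteq> {}"
      moreover have "rel c" using Suc.prems by (simp add: rel_def)
      ultimately have "\<exists>c. rel c \<and> supp c \<noteq> {}" by blast
      \<comment> \<open>Among the relations of true degree \<open>Suc d\<close>, one with the fewest
        top-degree terms.\<close>
      then obtain c where c: "rel c" "supp c \<noteq> {}"
        and least: "\<And>c'. rel c' \<Longrightarrow> supp c' \<noteq> {} \<Longrightarrow> card (supp c) \<le> card (supp c')"
        using ex_has_least_nat[of "\<lambda>c. rel c \<and> supp c \<noteq> {}" _ "\<lambda>c. card (supp c)"] by blast
      obtain M0 where M0: "M0 \<in> top" "c M0 \<noteq> 0" using c by (auto simp: supp_def)
      \<comment> \<open>Normalised to have the coefficient \<open>1\<close>, which
        \<open>\<tau>\<close> fixes, at \<open>M0\<close>.\<close>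
      define a where "a M = inverse (c M0) * c M" for M
      have aK: "a M \<in> K" for M using c by (auto simp: a_def rel_def intro: K_mult K_inverse)
      have asum: "(\<Sum>M\<in>msets m (Suc d). a M * monom_val f M) = 0"
        using c by (simp add: a_def rel_def mult.assoc flip: sum_distrib_left)
      have supp_a: "supp a = supp c" using M0 by (auto simp: a_def supp_def)
      have aM0: "a M0 = 1" using M0 by (simp add: a_def)
      obtain t where t: "\<tau>_expansion f r M (t M)" for M
        using ex_\<tau>_expansion[of f r] f r by metis
      have tK: "\<And>M N. t M N \<in> K" and t0: "\<And>M N. \<not> N \<subseteq># M \<Longrightarrow> t M N = 0"
        and tM: "\<And>M. t M M = (-1) ^ size M"
        and tM1: "\<And>M i. i \<in># M \<Longrightarrow> t M (M - {#i#}) = (-1) ^ (size M - 1) * of_nat (count M i) * r i"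
        and tsum: "\<And>M. \<tau> (monom_val f M) = (\<Sum>N | N \<subseteq># M. t M N * monom_val f N)"
        using t unfolding \<tau>_expansion_def by blast+
      \<comment> \<open>The image of the relation under \<open>\<tau>\<close> minus
        \<open>(-1) ^ Suc d\<close> times the relation. Its top coefficients are
        \<open>\<tau> (a N) - a N\<close> up to sign, so the one at \<open>M0\<close> cancels;
        minimality then removes all top coefficients, and \<open>lower\<close> the rest.\<close>
      define b where "b N = (\<Sum>M\<in>msets m (Suc d). \<tau> (a M) * t M N) - (-1) ^ Suc d * a N" for N
      have bK: "b N \<in> K" for N unfolding b_def
        by (intro K_diff K_sum K_mult \<tau>_K aK tK K_power K_uminus K_1)
      have tsum': "\<tau> (monom_val f M) = (\<Sum>N\<in>msets m (Suc d). t M N * monom_val f N)"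
        if "M \<in> msets m (Suc d)" for M
        unfolding tsum by (rule sum.mono_neutral_left) (use that msets_subset t0 in auto)
      have "(\<Sum>N\<in>msets m (Suc d). (\<Sum>M\<in>msets m (Suc d). \<tau> (a M) * t M N) * monom_val f N)
          = (\<Sum>N\<in>msets m (Suc d). \<Sum>M\<in>msets m (Suc d). \<tau> (a M) * (t M N * monom_val f N))"
        by (simp add: sum_distrib_right mult.assoc)
      also have "\<dots> = (\<Sum>M\<in>msets m (Suc d). \<tau> (a M) * (\<Sum>N\<in>msets m (Suc d). t M N * monom_val f N))"
        by (subst sum.swap) (simp add: sum_distrib_left)
      also have "\<dots> = (\<Sum>M\<in>msets m (Suc d). \<tau> (a M * monom_val f M))"
        by (rule sum.cong) (simp_all add: tsum' \<tau>_mult)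
      also have "\<dots> = \<tau> (\<Sum>M\<in>msets m (Suc d). a M * monom_val f M)"
        by (simp add: \<tau>_sum)
      finally have "(\<Sum>N\<in>msets m (Suc d). (\<Sum>M\<in>msets m (Suc d). \<tau> (a M) * t M N) * monom_val f N) = 0"
        by (simp add: asum)
      moreover have "(\<Sum>N\<in>msets m (Suc d). (-1) ^ Suc d * a N * monom_val f N) = 0"
        using asum by (simp add: mult.assoc sum_negf flip: sum_distrib_left)
      ultimately have bsum: "(\<Sum>N\<in>msets m (Suc d). b N * monom_val f N) = 0"
        unfolding b_def left_diff_distrib sum_subtractf by simp
      have rel_b: "rel b" using bK bsum by (simp add: rel_def)
      have b_top: "b N = (-1) ^ Suc d * (\<tau> (a N) - a N)" if N: "N \<in> top" for N
      proof -
        have "(\<Sum>M\<in>msets m (Suc d). \<tau> (a M) * t M N) = (\<Sum>M\<in>{N}. \<tau> (a M) * t M N)"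
        proof (rule sum.mono_neutral_right)
          show "\<forall>M\<in>msets m (Suc d) - {N}. \<tau> (a M) * t M N = 0"
          proof
            fix M assume M: "M \<in> msets m (Suc d) - {N}"
            have "\<not> N \<subseteq># M"
            proof
              assume "N \<subseteq># M"
              then have "N \<subset># M" using M by auto
              then have "size N < size M" by (rule mset_subset_size)
              then show False using M N by (auto simp: top_def msets_def)
            qed
            then show "\<tau> (a M) * t M N = 0" using t0 by simp
          qed
        qed (use N top_sub in auto)
        then show ?thesis using N by (simp add: b_def tM top_def algebra_simps)
      qed
      have "supp b \<subset> supp a"
      proof
        show "supp b \<subseteq> supp a" using b_top by (auto simp: supp_def)
        have "M0 \<in> supp a" "M0 \<notin> supp b" using M0 aM0 b_top by (auto simp: supp_def \<tau>_1)
        then show "supp b \<noteq> supp a" by blast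
      qed
      then have "card (supp b) < card (supp c)" using fin_supp supp_a by (metis psubset_card_mono)
      then have supp_b: "supp b = {}" using least[OF rel_b] by force
      then have b0: "b N = 0" if "N \<in> msets m (Suc d)" for N using lower[OF rel_b] that by blast
      have a_const: "\<tau> (a N) = a N" if "N \<in> top" for N
        using b0[of N] b_top[of N] that top_sub by auto
      \<comment> \<open>The coefficient of \<open>b\<close> at \<open>N\<close>, one degree below
        the top, receives contributions only from \<open>N\<close> itself and from the top monomials
        \<open>add_mset i N\<close>.\<close>
      obtain i0 N where i0: "M0 = add_mset i0 N"
        using M0 by (cases M0) (auto simp: top_def)
      have i0m: "i0 \<le> m" and Nm: "set_mset N \<subseteq> {..m}" and Nd: "size N = d"
        using M0 i0 by (auto simp: top_def)
      have up: "add_mset i N \<in> top" if "i \<le> m" for i using that Nm Nd by (auto simp: top_def)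
      \<comment> \<open>The factor \<open>Suc (count N i)\<close> is the multiplicity of
        \<open>i\<close> in \<open>add_mset i N\<close>, as supplied by the second layer of the
        expansion.\<close>
      define l where "l i = (if i \<le> m then of_nat (Suc (count N i)) * a (add_mset i N) else 0)" for i
      have l_const: "l i \<in> K \<and> \<tau> (l i) = l i" for i
        using a_const up aK by (auto simp: l_def \<tau>_mult \<tau>_of_nat simp del: of_nat_Suc intro!: K_mult K_0 K_of_nat)
      have l_nz: "l i0 \<noteq> 0" using i0m i0 aM0 by (simp add: l_def del: of_nat_Suc)
      have N_in: "N \<in> msets m (Suc d)" "N \<notin> top" using Nm Nd by (auto simp: msets_def top_def)
      have "(\<Sum>M\<in>msets m (Suc d). \<tau> (a M) * t M N)
          = (\<Sum>M\<in>insert N ((\<lambda>i. add_mset i N) ` {..m}). \<tau> (a M) * t M N)"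
      proof (rule sum.mono_neutral_right)
        show "\<forall>M\<in>msets m (Suc d) - insert N ((\<lambda>i. add_mset i N) ` {..m}). \<tau> (a M) * t M N = 0"
        proof
          fix M assume M: "M \<in> msets m (Suc d) - insert N ((\<lambda>i. add_mset i N) ` {..m})"
          have "\<not> N \<subseteq># M"
          proof
            assume "N \<subseteq># M"
            then obtain N' where N': "M = N + N'" by (metis subset_mset.le_iff_add)
            have "size N' \<le> 1" using M Nd N' by (auto simp: msets_def)
            moreover have "N' \<noteq> {#}" using M N' by auto
            ultimately obtain i where "N' = {#i#}"
              by (metis One_nat_def le_Suc_eq le_zero_eq size_1_singleton_mset size_eq_0_iff_empty)
            then show False using M N' by (auto simp: msets_def)
          qed
          then show "\<tau> (a M) * t M N = 0" using t0 by simp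
        qed
      qed (use N_in up top_sub in auto)
      also have "\<dots> = \<tau> (a N) * t N N + (\<Sum>M\<in>(\<lambda>i. add_mset i N) ` {..m}. \<tau> (a M) * t M N)"
        by (rule sum.insert) auto
      also have "(\<Sum>M\<in>(\<lambda>i. add_mset i N) ` {..m}. \<tau> (a M) * t M N)
          = (\<Sum>i\<le>m. \<tau> (a (add_mset i N)) * t (add_mset i N) N)"
        by (subst sum.reindex) (auto simp: inj_on_def)
      also have "\<dots> = (\<Sum>i\<le>m. (-1) ^ d * (l i * r i))"
      proof (rule sum.cong)
        fix i assume "i \<in> {..m}"
        then have i: "i \<le> m" by simp
        have "t (add_mset i N) N = (-1) ^ d * of_nat (Suc (count N i)) * r i"
          using tM1[of i "add_mset i N"] Nd by simp
        then show "\<tau> (a (add_mset i N)) * t (add_mset i N) N = (-1) ^ d * (l i * r i)"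
          using a_const[OF up[OF i]] i by (simp add: l_def mult_ac)
      qed simp
      also have "\<dots> = (-1) ^ d * (\<Sum>i\<le>m. l i * r i)" by (simp add: sum_distrib_left)
      finally have "b N = (-1) ^ d * (\<tau> (a N) + (\<Sum>i\<le>m. l i * r i) + a N)"
        by (simp add: b_def tM Nd algebra_simps)
      then have eq: "\<tau> (a N) + (\<Sum>i\<le>m. l i * r i) + a N = 0" using b0[OF N_in(1)] by simp
      \<comment> \<open>The equation \<open>b N = 0\<close> says that this element changes sign
        under \<open>\<tau>\<close>; hence it vanishes, which gives the excluded linear
        relation.\<close>
      have "\<tau> (a N + (\<Sum>i\<le>m. l i * f i)) = \<tau> (a N) + (\<Sum>i\<le>m. l i * (r i - f i))"
        using l_const by (simp add: \<tau>_add \<tau>_sum \<tau>_mult f)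
      also have "\<dots> = - (a N + (\<Sum>i\<le>m. l i * f i))"
        using eq by (simp add: right_diff_distrib sum_subtractf) (simp add: algebra_simps eq_neg_iff_add_eq_0)
      finally have "a N + (\<Sum>i\<le>m. l i * f i) = 0" by (rule anti)
      then have "(\<Sum>i\<le>m. l i * f i) = - a N" by (simp add: eq_neg_iff_add_eq_0 add.commute)
      then have "(\<Sum>i\<le>m. l i * f i) \<in> K" using K_uminus aK by simp
      then show False using no_lin l_const l_nz i0m by blast
    qed
    moreover have "rel c" using Suc.prems by (simp add: rel_def)
    ultimately show ?case using lower by blast
  qed
  then show False using c0 cK csum by blast
qed

end

section \<open>Polynomial functions and linear changes of variables\<close>

definition poly_fun :: "'a::comm_ring_1 set \<Rightarrow> nat \<Rightarrow> ((nat \<Rightarrow> 'a) \<Rightarrow> 'a) \<Rightarrow> bool" where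
  "poly_fun K m \<Phi> \<longleftrightarrow> (\<exists>d c. (\<forall>M. c M \<in> K) \<and> \<Phi> = (\<lambda>v. \<Sum>M\<in>msets m d. c M * monom_val v M))"

context difference_field
begin

lemma poly_fun_const: "a \<in> K \<Longrightarrow> poly_fun K m (\<lambda>v. a)"
  unfolding poly_fun_def
proof (intro exI conjI allI ext)
  assume a: "a \<in> K"
  show "(if M = {#} then a else 0) \<in> K" for M :: "nat multiset" using a K_0 by simp
  have "msets m 0 = {{#}}" by (auto simp: msets_def)
  then show "a = (\<Sum>M\<in>msets m 0. (if M = {#} then a else 0) * monom_val v M)" for v :: "nat \<Rightarrow> 'a"
    by simp
qed

lemma poly_fun_add:
  assumes "poly_fun K m \<Phi>" "poly_fun K m \<Psi>"
  shows "poly_fun K m (\<lambda>v. \<Phi> v + \<Psi> v)"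
proof -
  obtain d c where c: "\<And>M. c M \<in> K" "\<Phi> = (\<lambda>v. \<Sum>M\<in>msets m d. c M * monom_val v M)"
    using assms by (auto simp: poly_fun_def)
  obtain e b where b: "\<And>M. b M \<in> K" "\<Psi> = (\<lambda>v. \<Sum>M\<in>msets m e. b M * monom_val v M)"
    using assms by (auto simp: poly_fun_def)
  define a where "a M = (if M \<in> msets m d then c M else 0) + (if M \<in> msets m e then b M else 0)" for M
  have sub: "msets m d \<subseteq> msets m (max d e)" "msets m e \<subseteq> msets m (max d e)" by (auto simp: msets_def)
  have "(\<Sum>M\<in>msets m (max d e). a M * monom_val v M) = \<Phi> v + \<Psi> v" for v
  proof -
    have "(\<Sum>M\<in>msets m (max d e). (if M \<in> msets m d then c M else 0) * monom_val v M) = \<Phi> v"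
      unfolding c by (rule sum.mono_neutral_cong_right) (use sub in auto)
    moreover have "(\<Sum>M\<in>msets m (max d e). (if M \<in> msets m e then b M else 0) * monom_val v M) = \<Psi> v"
      unfolding b by (rule sum.mono_neutral_cong_right) (use sub in auto)
    ultimately show ?thesis by (simp only: a_def distrib_right sum.distrib)
  qed
  moreover have "a M \<in> K" for M using b c K_0 by (auto simp: a_def intro: K_add)
  ultimately show ?thesis unfolding poly_fun_def by metis
qed

lemma poly_fun_scale:
  assumes "a \<in> K" "poly_fun K m \<Phi>"
  shows "poly_fun K m (\<lambda>v. a * \<Phi> v)"
proof -
  obtain d c where c: "\<And>M. c M \<in> K" "\<Phi> = (\<lambda>v. \<Sum>M\<in>msets m d. c M * monom_val v M)"
    using assms by (auto simp: poly_fun_def)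
  have "(\<lambda>v. a * \<Phi> v) = (\<lambda>v. \<Sum>M\<in>msets m d. (a * c M) * monom_val v M)"
    by (simp add: c sum_distrib_left mult.assoc)
  moreover have "\<forall>M. a * c M \<in> K" using assms c K_mult by blast
  ultimately show ?thesis unfolding poly_fun_def
    by (intro exI[of _ d] exI[of _ "\<lambda>M. a * c M"]) simp
qed

lemma poly_fun_mult_var:
  assumes "i \<le> m" "poly_fun K m \<Phi>"
  shows "poly_fun K m (\<lambda>v. v i * \<Phi> v)"
proof -
  obtain d c where c: "\<And>M. c M \<in> K" "\<Phi> = (\<lambda>v. \<Sum>M\<in>msets m d. c M * monom_val v M)"
    using assms by (auto simp: poly_fun_def)
  define a where "a L = (if i \<in># L then c (L - {#i#}) else 0)" for L
  have "(\<Sum>L\<in>msets m (Suc d). a L * monom_val v L) = v i * \<Phi> v" for v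
  proof -
    have "(\<Sum>L\<in>msets m (Suc d). a L * monom_val v L) = (\<Sum>L\<in>{L\<in>msets m (Suc d). i \<in># L}. c (L - {#i#}) * monom_val v L)"
      by (rule sum.mono_neutral_cong_right) (auto simp: a_def)
    also have "\<dots> = (\<Sum>M\<in>msets m d. c M * monom_val v (add_mset i M))"
      by (rule sum.reindex_bij_witness[of _ "add_mset i" "\<lambda>L. L - {#i#}"])
         (use \<open>i \<le> m\<close> in \<open>auto simp: msets_def size_Diff_singleton dest: in_diffD\<close>)
    also have "\<dots> = v i * \<Phi> v" by (simp add: c sum_distrib_left mult_ac)
    finally show ?thesis .
  qed
  moreover have "a L \<in> K" for L using c K_0 by (auto simp: a_def)
  ultimately show ?thesis unfolding poly_fun_def by metis
qed

lemma poly_fun_sum: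
  "(\<And>x. x \<in> A \<Longrightarrow> poly_fun K m (\<Phi> x)) \<Longrightarrow> poly_fun K m (\<lambda>v. \<Sum>x\<in>A. \<Phi> x v)"
proof (induction A rule: infinite_finite_induct)
  case (insert x A)
  then show ?case using poly_fun_add[of m "\<Phi> x" "\<lambda>v. \<Sum>x\<in>A. \<Phi> x v"] by simp
qed (simp_all add: poly_fun_const K_0)

lemma poly_fun_mult_linear:
  assumes "\<And>j. j \<in> J \<Longrightarrow> \<alpha> j \<in> K" "J \<subseteq> {..m}" "poly_fun K m \<Phi>"
  shows "poly_fun K m (\<lambda>v. (\<Sum>j\<in>J. \<alpha> j * v j) * \<Phi> v)"
proof -
  have "poly_fun K m (\<lambda>v. \<Sum>j\<in>J. \<alpha> j * (v j * \<Phi> v))"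
    using assms by (intro poly_fun_sum poly_fun_scale poly_fun_mult_var) auto
  then show ?thesis by (simp add: sum_distrib_right mult.assoc)
qed

text \<open>Monomials evaluated at linear forms, needed for the change from derivatives to iterates
  of \<open>x^2 d/dx\<close>. Only the existence of coefficients is recorded; nontriviality will be
  tested on values.\<close>

lemma poly_fun_prod_linear:
  assumes "\<And>i j. \<alpha> i j \<in> K" "\<And>i. i \<in> I \<Longrightarrow> J i \<subseteq> {..m}"
  shows "poly_fun K m (\<lambda>v. \<Prod>i\<in>I. (\<Sum>j\<in>J i. \<alpha> i j * v j) ^ e i)"
  using assms(2)
proof (induction I rule: infinite_finite_induct)
  case (insert i I)
  have "poly_fun K m (\<lambda>v. (\<Sum>j\<in>J i. \<alpha> i j * v j) ^ n * (\<Prod>i\<in>I. (\<Sum>j\<in>J i. \<alpha> i j * v j) ^ e i))" for n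
  proof (induction n)
    case 0
    show ?case using insert by simp
  next
    case (Suc n)
    show ?case using poly_fun_mult_linear[OF _ _ Suc, of "J i" "\<alpha> i"] assms(1) insert.prems
      by (simp add: mult.assoc)
  qed
  then show ?case using insert by simp
qed (simp_all add: poly_fun_const K_1)

end

text \<open>Reduction modulo \<open>N\<close> reads off the lowest digit, and induction handles the
  quotient.\<close>

lemma digits_inj:
  fixes N :: nat
  assumes "\<And>i. e i < N" "\<And>i. e' i < N" "(\<Sum>i<m. e i * N ^ i) = (\<Sum>i<m. e' i * N ^ i)" "i < m"
  shows "e i = e' i"
  using assms
proof (induction m arbitrary: e e' i)
  case (Suc m)
  have split: "(\<Sum>i<Suc m. e i * N ^ i) = e 0 + N * (\<Sum>i<m. e (Suc i) * N ^ i)" for e :: "nat \<Rightarrow> nat"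
    unfolding sum.lessThan_Suc_shift by (simp add: sum_distrib_left mult_ac)
  have eq: "e 0 + N * (\<Sum>i<m. e (Suc i) * N ^ i) = e' 0 + N * (\<Sum>i<m. e' (Suc i) * N ^ i)"
    using Suc.prems(3) unfolding split .
  have "(e 0 + N * (\<Sum>i<m. e (Suc i) * N ^ i)) mod N = e 0" "(e' 0 + N * (\<Sum>i<m. e' (Suc i) * N ^ i)) mod N = e' 0"
    using Suc.prems(1,2)[of 0] by simp_all
  then have e0: "e 0 = e' 0" using eq by simp
  then have tail: "(\<Sum>i<m. e (Suc i) * N ^ i) = (\<Sum>i<m. e' (Suc i) * N ^ i)"
    using eq Suc.prems(1)[of 0] by simp
  show ?case
  proof (cases i)
    case 0
    then show ?thesis using e0 by simp
  next
    case (Suc k)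
    then show ?thesis
      using Suc.IH[of "\<lambda>i. e (Suc i)" "\<lambda>i. e' (Suc i)" k] Suc.prems tail by simp
  qed
qed simp

text \<open>Kronecker substitution \<open>w i = t ^ (N ^ i)\<close>.\<close>

lemma nonzero_coeffs_imp_nonzero_value:
  fixes c :: "(nat \<Rightarrow> nat) \<Rightarrow> 'a::{idom,ring_char_0}"
  assumes fin: "finite E" and ne: "E \<noteq> {}" and c: "\<And>e. e \<in> E \<Longrightarrow> c e \<noteq> 0"
    and supp: "\<And>e i. e \<in> E \<Longrightarrow> i > m \<Longrightarrow> e i = 0"
  shows "\<exists>w. (\<Sum>e\<in>E. c e * (\<Prod>i\<le>m. w i ^ e i)) \<noteq> 0"
proof -
  define N where "N = Suc (Max ((\<lambda>(e, i). e i) ` (E \<times> {..Suc m})))"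
  have bound: "e i < N" if "e \<in> E" for e i
  proof (cases "i \<le> m")
    case True
    then have "e i \<in> (\<lambda>(e, i). e i) ` (E \<times> {..Suc m})" using that by force
    then show ?thesis unfolding N_def using fin by (simp add: le_imp_less_Suc)
  next
    case False
    then show ?thesis using supp[OF that, of i] by (simp add: N_def)
  qed
  define \<kappa> where "\<kappa> e = (\<Sum>i<Suc m. e i * N ^ i)" for e :: "nat \<Rightarrow> nat"
  have inj: "e = e'" if "e \<in> E" "e' \<in> E" "\<kappa> e = \<kappa> e'" for e e'
  proof
    fix i
    show "e i = e' i"
    proof (cases "i < Suc m")
      case True
      then show ?thesis using digits_inj[of e N e' "Suc m" i] that bound by (simp only: \<kappa>_def)
    next
      case False
      then show ?thesis using supp[of e i] supp[of e' i] that by simp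
    qed
  qed
  define p where "p = (\<Sum>e\<in>E. monom (c e) (\<kappa> e))"
  obtain e0 where e0: "e0 \<in> E" using ne by blast
  have "coeff p (\<kappa> e0) = (\<Sum>e\<in>E. if e = e0 then c e else 0)"
    unfolding p_def coeff_sum by (rule sum.cong) (use inj e0 in auto)
  also have "\<dots> = c e0" using fin e0 by simp
  finally have "p \<noteq> 0" using c[OF e0] by auto
  then obtain t where t: "poly p t \<noteq> 0" using poly_all_0_iff_0 by blast
  have "poly p t = (\<Sum>e\<in>E. c e * (\<Prod>i\<le>m. (t ^ (N ^ i)) ^ e i))"
    unfolding p_def poly_sum
  proof (rule sum.cong)
    fix e
    have "(\<Prod>i\<le>m. (t ^ (N ^ i)) ^ e i) = t ^ \<kappa> e"
      by (simp add: \<kappa>_def power_sum mult.commute lessThan_Suc_atMost flip: power_mult)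
    then show "poly (monom (c e) (\<kappa> e)) t = c e * (\<Prod>i\<le>m. (t ^ (N ^ i)) ^ e i)" by (simp add: poly_monom)
  qed simp
  then show ?thesis using t by metis
qed

text \<open>Forward substitution.\<close>

lemma triangular_solvable:
  fixes \<alpha> :: "nat \<Rightarrow> nat \<Rightarrow> 'a::field"
  assumes "\<And>i. \<alpha> i i \<noteq> 0"
  shows "\<exists>v. \<forall>i\<le>m. (\<Sum>j\<le>i. \<alpha> i j * v j) = w i"
proof (induction m)
  case 0
  show ?case by (rule exI[of _ "\<lambda>_. w 0 / \<alpha> 0 0"]) (simp add: assms)
next
  case (Suc m)
  then obtain v where v: "\<And>i. i \<le> m \<Longrightarrow> (\<Sum>j\<le>i. \<alpha> i j * v j) = w i" by blast
  define u where "u = v(Suc m := (w (Suc m) - (\<Sum>j\<le>m. \<alpha> (Suc m) j * v j)) / \<alpha> (Suc m) (Suc m))"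
  have "(\<Sum>j\<le>i. \<alpha> i j * u j) = w i" if "i \<le> Suc m" for i
  proof (cases "i = Suc m")
    case True
    have "(\<Sum>j\<le>m. \<alpha> (Suc m) j * u j) = (\<Sum>j\<le>m. \<alpha> (Suc m) j * v j)"
      by (rule sum.cong) (auto simp: u_def)
    then show ?thesis by (simp add: True u_def assms)
  next
    case False
    then have "(\<Sum>j\<le>i. \<alpha> i j * u j) = (\<Sum>j\<le>i. \<alpha> i j * v j)"
      using that by (intro sum.cong) (auto simp: u_def)
    then show ?thesis using v False that by simp
  qed
  then show ?case by blast
qed

section \<open>Strong differential transcendence\<close>

text \<open>Describing germs as Laurent expansions of actual functions makes the closure rules for
  such expansions available.\<close>

lemma meromorphic_germ_iff: "meromorphic_germ g \<longleftrightarrow> (\<exists>\<phi>. \<phi> has_laurent_expansion g)"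
proof -
  have "meromorphic_germ g \<longleftrightarrow> fls_conv_radius g > 0"
    by (simp add: meromorphic_germ_def fls_conv_radius_altdef)
  then show ?thesis using eval_fls_has_laurent_expansion unfolding has_laurent_expansion_def by blast
qed

lemma meromorphic_germ_fps: "meromorphic_germ (fps_to_fls F) \<longleftrightarrow> fps_conv_radius F > 0"
  unfolding meromorphic_germ_def fls_conv_radius_altdef[symmetric] by simp

lemma moebius_nz [simp]: "moebius \<noteq> 0"
  using moebius_eq by force

lemma moebius_power_lead: "fps_nth (moebius ^ k) k = 1"
  using moebius_power_nth[of "k - 1" "k - 1"] by (cases k) auto

definition moebius_subst :: "complex fls \<Rightarrow> complex fls" where
  "moebius_subst g = fls_compose_fps g moebius"

lemma meromorphic_germ_moebius: "meromorphic_germ (fps_to_fls moebius)"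
proof -
  have "(\<lambda>z. z / (1 - \<i> * z)) has_fps_expansion moebius"
    unfolding moebius_def by (intro fps_expansion_intros) auto
  then show ?thesis by (meson has_laurent_expansion_fps meromorphic_germ_iff)
qed

text \<open>Closure under substitution holds because the Moebius map is itself a convergent nonzero
  series that vanishes at \<open>0\<close>.\<close>

interpretation germs: difference_field "{g. meromorphic_germ g}" moebius_subst
proof
  fix a b :: "complex fls"
  show "1 \<in> {g. meromorphic_germ g}" by (auto simp: meromorphic_germ_iff intro: laurent_expansion_intros)
  show "a \<in> {g. meromorphic_germ g} \<Longrightarrow> b \<in> {g. meromorphic_germ g} \<Longrightarrow> a + b \<in> {g. meromorphic_germ g}"
    "a \<in> {g. meromorphic_germ g} \<Longrightarrow> - a \<in> {g. meromorphic_germ g}"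
    "a \<in> {g. meromorphic_germ g} \<Longrightarrow> b \<in> {g. meromorphic_germ g} \<Longrightarrow> a * b \<in> {g. meromorphic_germ g}"
    "a \<in> {g. meromorphic_germ g} \<Longrightarrow> inverse a \<in> {g. meromorphic_germ g}"
    by (auto simp: meromorphic_germ_iff intro: laurent_expansion_intros)
  show "moebius_subst 1 = 1" "moebius_subst (a + b) = moebius_subst a + moebius_subst b" "moebius_subst (a * b) = moebius_subst a * moebius_subst b"
    by (simp_all add: moebius_subst_def fls_compose_fps_add fls_compose_fps_mult)
  show "moebius_subst a \<in> {g. meromorphic_germ g}" if "a \<in> {g. meromorphic_germ g}"
    using that meromorphic_germ_moebius has_laurent_expansion_compose[OF _ _ moebius_nth_0 moebius_nz]
    unfolding moebius_subst_def meromorphic_germ_iff mem_Collect_eq by blast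
qed

lemma meromorphic_germ_deriv: "meromorphic_germ g \<Longrightarrow> meromorphic_germ (fls_deriv g)"
  by (auto simp: meromorphic_germ_iff intro: has_laurent_expansion_deriv)

lemma meromorphic_germ_X: "meromorphic_germ fls_X"
  by (auto simp: meromorphic_germ_iff intro: laurent_expansion_intros)

lemma moebius_subst_fps: "moebius_subst (fps_to_fls F) = fps_to_fls (F oo moebius)"
  by (simp add: moebius_subst_def)

text \<open>Reduces statements that are stable under inversion to power series, for which leading
  coefficients can be compared.\<close>

lemma fls_cases_inverse:
  fixes h :: "complex fls"
  obtains G where "h = fps_to_fls G" | G where "inverse h = fps_to_fls G"
proof (cases "fls_subdegree h \<ge> 0")
  case True
  then have "h = fps_to_fls (fls_regpart h)" by (simp add: fls_regpart_to_fls_trivial)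
  then show ?thesis using that(1) by blast
next
  case False
  then have "fls_subdegree (inverse h) \<ge> 0" by simp
  then have "inverse h = fps_to_fls (fls_regpart (inverse h))" by (simp add: fls_regpart_to_fls_trivial)
  then show ?thesis using that(2) by blast
qed

text \<open>The Moebius map is tangent to the identity, so composition keeps the lowest coefficient;
  a change of sign forces it to vanish.\<close>

lemma moebius_subst_antiinvariant:
  assumes "moebius_subst h = - h"
  shows "h = 0"
proof -
  have fps: "G = 0" if "moebius_subst (fps_to_fls G) = - fps_to_fls G" for G
  proof (rule ccontr)
    assume nz: "G \<noteq> 0"
    have "fps_to_fls (G oo moebius) = fps_to_fls (- G)" using that by (simp add: moebius_subst_fps)
    then have "G oo moebius = - G" by (simp only: fps_to_fls_eq_iff)
    moreover define k where "k = subdegree G"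
    have "fps_nth (G oo moebius) k = (\<Sum>i\<in>{k}. fps_nth G i * fps_nth (moebius ^ i) k)"
      unfolding fps_compose_nth by (rule sum.mono_neutral_right) (auto simp: k_def intro: nth_less_subdegree_zero)
    then have "fps_nth (G oo moebius) k = fps_nth G k" by (simp add: moebius_power_lead)
    ultimately have "fps_nth G k = 0" by simp
    then show False using nz by (simp add: k_def)
  qed
  show ?thesis
  proof (cases h rule: fls_cases_inverse)
    case (1 G)
    then show ?thesis using fps[of G] assms by simp
  next
    case (2 G)
    have "moebius_subst (inverse h) = - inverse h"
      using assms by (simp add: moebius_subst_def fls_compose_fps_inverse)
    then have "G = 0" using 2 fps[of G] by simp
    then show ?thesis using 2 by simp
  qed
qed

text \<open>If the nonconstant part begins in degree \<open>k > 0\<close>, composition changes the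
  coefficient of degree \<open>k + 1\<close> by \<open>k * \<i>\<close> times the lowest one, which
  is not zero.\<close>

lemma moebius_subst_invariant:
  assumes "moebius_subst h = h"
  shows "\<exists>c. h = fls_const c"
proof -
  have fps: "\<exists>c. G = fps_const c" if "moebius_subst (fps_to_fls G) = fps_to_fls G" for G
  proof -
    have "fps_to_fls (G oo moebius) = fps_to_fls G" using that by (simp add: moebius_subst_fps)
    then have inv: "G oo moebius = G" by (simp only: fps_to_fls_eq_iff)
    define H where "H = G - fps_const (fps_nth G 0)"
    have invH: "H oo moebius = H" by (simp add: H_def fps_compose_sub_distrib inv)
    have "H = 0"
    proof (rule ccontr)
      assume nz: "H \<noteq> 0"
      define k where "k = subdegree H"
      have "fps_nth H 0 = 0" by (simp add: H_def)
      then have "k \<noteq> 0" using nz nth_subdegree_nonzero[OF nz] by (metis k_def)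
      then obtain j where j: "k = Suc j" by (cases k) auto
      have "fps_nth (H oo moebius) (Suc k) = (\<Sum>i\<in>{k, Suc k}. fps_nth H i * fps_nth (moebius ^ i) (Suc k))"
        unfolding fps_compose_nth by (rule sum.mono_neutral_right) (auto simp: k_def le_Suc_eq intro: nth_less_subdegree_zero)
      also have "\<dots> = fps_nth H k * fps_nth (moebius ^ k) (Suc k) + fps_nth H (Suc k)"
        using moebius_power_lead[of "Suc k"] by (simp del: power_Suc)
      finally have "fps_nth H k * fps_nth (moebius ^ k) (Suc k) = 0" by (simp add: invH)
      moreover have "fps_nth (moebius ^ k) (Suc k) \<noteq> 0"
        using moebius_power_nth[of j k] by (simp add: j del: power_Suc of_nat_Suc)
      ultimately show False using nz by (simp add: k_def)
    qed
    then show ?thesis by (auto simp: H_def)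
  qed
  show ?thesis
  proof (cases h rule: fls_cases_inverse)
    case (1 G)
    then show ?thesis using fps[of G] assms by auto
  next
    case (2 G)
    have "moebius_subst (inverse h) = inverse h"
      using assms by (simp add: moebius_subst_def fls_compose_fps_inverse)
    then obtain c where "G = fps_const c" using 2 fps[of G] by auto
    then have "inverse h = fls_const c" using 2 by simp
    then have "h = fls_const (inverse c)" by (metis fls_inverse_const inverse_inverse_eq)
    then show ?thesis by blast
  qed
qed

section \<open>The derivation \<open>x^2 d/dx\<close> and its compatibility with the Moebius
  map\<close>

definition delta :: "complex fps \<Rightarrow> complex fps" where
  "delta F = fps_X ^ 2 * fps_deriv F"

text \<open>The derivation is \<open>- d/du\<close> for \<open>u = 1/x\<close>, and the Moebius map
  translates \<open>u\<close>; this is the resulting invariance, in the form needed for the chain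
  rule.\<close>

lemma delta_moebius: "delta moebius = moebius ^ 2"
proof -
  let ?z = "1 - fps_const \<i> * fps_X :: complex fps"
  have "fps_deriv moebius * ?z = 1 + fps_const \<i> * moebius"
    using arg_cong[OF moebius_eq, of fps_deriv] by (simp add: algebra_simps)
  then have "delta moebius * ?z = fps_X * (fps_X + fps_const \<i> * fps_X * moebius)"
    by (simp add: delta_def power2_eq_square mult.assoc) (simp add: algebra_simps)
  also have "\<dots> = fps_X * moebius" by (simp flip: moebius_rec)
  also have "\<dots> = moebius ^ 2 * ?z" using moebius_eq by (simp add: power2_eq_square mult.assoc) 
  finally have "delta moebius * ?z = moebius ^ 2 * ?z" .
  moreover have "?z \<noteq> 0" using moebius_eq by force
  ultimately show ?thesis by simp
qed

lemma delta_compose: "delta (F oo moebius) = delta F oo moebius"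
proof -
  have "delta (F oo moebius) = (fps_deriv F oo moebius) * delta moebius"
    by (simp add: delta_def fps_compose_deriv mult_ac)
  also have "\<dots> = delta F oo moebius"
    unfolding delta_moebius by (simp add: delta_def fps_compose_mult_distrib fps_compose_power[symmetric] mult_ac)
  finally show ?thesis .
qed

lemma delta_add: "delta (F + G) = delta F + delta G"
  by (simp add: delta_def algebra_simps)

lemma delta_iter_FE:
  "(delta ^^ i) shifted_Q + ((delta ^^ i) shifted_Q oo moebius) = (delta ^^ i) (2 * fps_X * moebius)"
  by (induction i) (simp_all add: shifted_Q_functional_equation flip: delta_add delta_compose)

lemma meromorphic_germ_delta_iter:
  "meromorphic_germ (fps_to_fls ((delta ^^ i) (2 * fps_X * moebius)))"
proof (induction i)
  case 0
  have "meromorphic_germ (of_nat 2 * fls_X * fps_to_fls moebius)"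
    using germs.K_mult germs.K_of_nat[of 2] meromorphic_germ_X meromorphic_germ_moebius by blast
  then show ?case by (simp add: fls_times_fps_to_fls)
next
  case (Suc i)
  then have "meromorphic_germ (fls_X ^ 2 * fls_deriv (fps_to_fls ((delta ^^ i) (2 * fps_X * moebius))))"
    using germs.K_mult germs.K_power meromorphic_germ_X meromorphic_germ_deriv by blast
  then show ?case
    by (simp add: delta_def[of "(delta ^^ i) _"] fls_times_fps_to_fls fls_deriv_fps_to_fls fps_to_fls_power)
qed

text \<open>Coefficients of at most geometric growth, divided by factorials, give an entire
  function.\<close>

lemma borel_fps_conv_radius:
  assumes "fps_conv_radius H > 0"
  shows "fps_conv_radius (borel_fps H) = \<infinity>"
proof -
  obtain r :: real where r: "r > 0" "ereal r < fps_conv_radius H"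
    using ereal_dense2[OF assms] by (auto simp: zero_ereal_def)
  have "summable (\<lambda>n. fps_nth H n * of_real r ^ n)"
    using r by (intro summable_in_conv_radius) (simp add: fps_conv_radius_def)
  then have "Bseq (\<lambda>n. fps_nth H n * of_real r ^ n)"
    by (intro convergent_imp_Bseq) (auto simp: convergent_def dest: summable_LIMSEQ_zero)
  then obtain C where C: "\<And>n. norm (fps_nth H n * of_real r ^ n) \<le> C" by (auto simp: Bseq_def)
  have bound: "norm (fps_nth H n) \<le> C / r ^ n" for n
    using C[of n] r by (simp add: norm_mult norm_power pos_le_divide_eq)
  have "conv_radius (fps_nth (borel_fps H)) \<ge> ereal R" for R
  proof (cases "R \<ge> 0")
    case True
    have "summable (\<lambda>n. C / r * ((R / r) ^ n / fact n))"
      using summable_exp_generic[of "R / r"] by (intro summable_mult) (simp add: divide_inverse mult_ac)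
    then have "summable (\<lambda>n. fps_nth (borel_fps H) n * of_real R ^ n)"
    proof (rule summable_comparison_test_ev[rotated], intro always_eventually allI)
      fix n
      have "norm (fps_nth (borel_fps H) n * of_real R ^ n) = norm (fps_nth H (Suc n)) * (R ^ n / fact n)"
        using True by (simp add: norm_mult norm_divide norm_power)
      also have "\<dots> \<le> C / r ^ Suc n * (R ^ n / fact n)"
        using True by (intro mult_right_mono bound) auto
      also have "\<dots> = C / r * ((R / r) ^ n / fact n)" by (simp add: power_divide)
      finally show "norm (fps_nth (borel_fps H) n * of_real R ^ n) \<le> C / r * ((R / r) ^ n / fact n)" .
    qed
    then have "ereal (norm (complex_of_real R)) \<le> conv_radius (fps_nth (borel_fps H))" by (rule conv_radius_geI)
    then show ?thesis using True by simp
  next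
    case False
    then have "ereal R \<le> 0" by simp
    then show ?thesis using conv_radius_nonneg order_trans by blast
  qed
  then show ?thesis unfolding fps_conv_radius_def by (metis ereal_top)
qed

lemma borel_fps_delta: "borel_fps (delta F) = fps_X * borel_fps F"
  unfolding delta_def by (rule borel_fps_deriv)

lemma borel_fps_delta_iter: "borel_fps ((delta ^^ i) F) = fps_X ^ i * borel_fps F"
  by (induction i) (simp_all add: borel_fps_delta mult_ac)

text \<open>The Borel transform of the combination is \<open>p T\<close> with \<open>p\<close> the
  polynomial of the \<open>c i\<close>. If it is entire, \<open>p\<close> must cancel all poles of
  the tangent, hence has infinitely many roots.\<close>

lemma delta_combination_divergent:
  assumes conv: "fps_conv_radius (\<Sum>i\<le>m. fps_const (c i) * (delta ^^ i) shifted_Q) > 0"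
    and "i \<le> m"
  shows "c i = 0"
proof -
  define H where "H = (\<Sum>i\<le>m. fps_const (c i) * (delta ^^ i) shifted_Q)"
  define p where "p = (\<Sum>i\<le>m. monom (c i) i)"
  define T where "T = borel_fps shifted_Q"
  have "borel_fps H = (\<Sum>i\<le>m. fps_const (c i) * fps_X ^ i) * T"
    by (simp add: H_def borel_fps_sum borel_fps_const_mult borel_fps_delta_iter T_def sum_distrib_right mult.assoc)
  also have "(\<Sum>i\<le>m. fps_const (c i) * fps_X ^ i) = fps_of_poly p"
    by (simp add: p_def fps_of_poly_sum fps_of_poly_monom)
  finally have "borel_fps H * fps_cos (1/2) = fps_of_poly p * (T * fps_cos (1/2))" by (simp add: mult.assoc)
  also have "T * fps_cos (1/2) = 2 * fps_sin (1/2)"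
    by (rule tan_cos[OF shifted_Q_functional_equation T_def])
  finally have eq: "borel_fps H * fps_cos (1/2) = fps_of_poly p * (2 * fps_sin (1/2))" .
  have rad: "fps_conv_radius (borel_fps H) = \<infinity>" using conv by (intro borel_fps_conv_radius) (simp add: H_def)
  have rad2: "fps_conv_radius (2 * fps_sin (1/2 :: complex)) = \<infinity>"
    using fps_conv_radius_mult[of 2 "fps_sin (1/2 :: complex)"] by simp
  have ev: "eval_fps (borel_fps H) z * cos (z / 2) = poly p z * (2 * sin (z / 2))" for z
  proof -
    have "eval_fps (borel_fps H * fps_cos (1/2)) z = eval_fps (borel_fps H) z * cos (z / 2)"
      by (subst eval_fps_mult) (simp_all add: rad)
    moreover have "eval_fps (fps_of_poly p * (2 * fps_sin (1/2))) z = poly p z * (2 * sin (z / 2))"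
      by (subst eval_fps_mult) (simp_all add: rad2 eval_fps_mult)
    ultimately show ?thesis using eq by simp
  qed
  \<comment> \<open>The odd multiples of \<open>\<pi>\<close>: zeros of \<open>cos (z / 2)\<close>
    at which \<open>sin (z / 2)\<close> does not vanish.\<close>
  define w where "w k = complex_of_real (real (2 * k + 1) * pi)" for k
  have root: "poly p (w k) = 0" for k
  proof -
    have "cos (real (2 * k + 1) * pi / 2) = 0"
      unfolding cos_zero_iff by (intro disjI1 exI[of _ "2 * k + 1"]) simp
    then have c0: "cos (w k / 2) = 0" unfolding w_def by (metis of_real_0 cos_of_real of_real_divide of_real_numeral)
    then have "sin (w k / 2) \<noteq> 0" using sin_cos_squared_add[of "w k / 2"] by auto
    then show ?thesis using ev[of "w k"] c0 by simp
  qed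
  have "inj w" by (auto simp: inj_def w_def)
  then have "infinite (range w)" by (simp add: finite_image_iff)
  moreover have "range w \<subseteq> {z. poly p z = 0}" using root by auto
  ultimately have "infinite {z. poly p z = 0}" using finite_subset by blast
  then have "p = 0" using poly_roots_finite by blast
  then have "coeff p i = 0" by simp
  then show ?thesis using \<open>i \<le> m\<close> by (simp add: p_def coeff_sum)
qed

lemma fps_to_fls_sum: "fps_to_fls (sum F A) = (\<Sum>x\<in>A. fps_to_fls (F x))"
  by (induction A rule: infinite_finite_induct) auto

text \<open>A polynomial relation would yield a linear one with invariant coefficients. These are
  constants, so a nontrivial constant combination of the iterates would converge.\<close>

lemma delta_iterates_independent:
  assumes cK: "\<And>M. meromorphic_germ (c M)"
    and csum: "(\<Sum>M\<in>msets m d. c M * monom_val (\<lambda>i. fps_to_fls ((delta ^^ i) shifted_Q)) M) = 0"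
    and "M \<in> msets m d"
  shows "c M = 0"
proof (rule ccontr)
  define f where "f i = fps_to_fls ((delta ^^ i) shifted_Q)" for i
  define r where "r i = fps_to_fls ((delta ^^ i) (2 * fps_X * moebius))" for i
  assume "c M \<noteq> 0"
  then have nz: "\<exists>M\<in>msets m d. c M \<noteq> 0" using \<open>M \<in> msets m d\<close> by blast
  have f: "moebius_subst (f i) = r i - f i" for i
    unfolding f_def r_def moebius_subst_fps delta_iter_FE[symmetric] by simp
  have "\<exists>l. (\<forall>i. l i \<in> {g. meromorphic_germ g} \<and> moebius_subst (l i) = l i) \<and> (\<exists>i\<le>m. l i \<noteq> 0) \<and>
     (\<Sum>i\<le>m. l i * f i) \<in> {g. meromorphic_germ g}"
    by (rule germs.algebraic_dependence_imp_linear[OF f _ moebius_subst_antiinvariant _ nz])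
       (use cK csum in \<open>auto simp: r_def meromorphic_germ_delta_iter f_def[abs_def]\<close>)
  then obtain l where l: "\<And>i. moebius_subst (l i) = l i" and lnz: "\<exists>i\<le>m. l i \<noteq> 0"
    and lK: "meromorphic_germ (\<Sum>i\<le>m. l i * f i)" by blast
  have "\<forall>i. \<exists>c. l i = fls_const c" using l moebius_subst_invariant by blast
  then obtain a where a: "\<And>i. l i = fls_const (a i)" by metis
  have "(\<Sum>i\<le>m. l i * f i) = fps_to_fls (\<Sum>i\<le>m. fps_const (a i) * (delta ^^ i) shifted_Q)"
    by (simp add: a f_def fps_to_fls_sum fls_times_fps_to_fls)
  then have "fps_conv_radius (\<Sum>i\<le>m. fps_const (a i) * (delta ^^ i) shifted_Q) > 0"
    using lK by (simp add: meromorphic_germ_fps)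
  then have "a i = 0" if "i \<le> m" for i using delta_combination_divergent that by blast
  then show False using lnz by (auto simp: a)
qed

text \<open>The matrix that expresses the derivatives of \<open>Q\<close> through the iterates of
  \<open>delta\<close> on \<open>x^2 Q\<close>; the recursion comes from
  \<open>d/dx = x^(-2) delta\<close> and the product rule.\<close>

fun deriv_coeff :: "nat \<Rightarrow> nat \<Rightarrow> complex fls" where
  "deriv_coeff 0 j = (if j = 0 then inverse fls_X ^ 2 else 0)"
| "deriv_coeff (Suc i) j = fls_deriv (deriv_coeff i j) + (if j = 0 then 0 else inverse fls_X ^ 2 * deriv_coeff i (j - 1))"

lemma deriv_coeff_germ: "meromorphic_germ (deriv_coeff i j)"
proof -
  note K = germs.K_add germs.K_mult germs.K_inverse germs.K_power germs.K_0
  show ?thesis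
    by (induction i arbitrary: j)
       (use K meromorphic_germ_X meromorphic_germ_deriv in \<open>auto simp del: power_inverse\<close>)
qed

lemma deriv_coeff_upper: "j > i \<Longrightarrow> deriv_coeff i j = 0"
  by (induction i arbitrary: j) auto

text \<open>The diagonal entry is \<open>x^(-2 i - 2)\<close>, so the triangular matrix is
  invertible.\<close>

lemma deriv_coeff_diag: "deriv_coeff i i \<noteq> 0"
  by (induction i) (auto simp: deriv_coeff_upper)

lemma deriv_QA_expansion:
  "fps_to_fls ((fps_deriv ^^ i) QA_half) = (\<Sum>j\<le>i. deriv_coeff i j * fps_to_fls ((delta ^^ j) shifted_Q))"
proof (induction i)
  case 0
  have "inverse fls_X ^ 2 * (fls_X ^ 2 :: complex fls) = 1" by (simp flip: power_mult_distrib)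
  then show ?case by (simp add: shifted_Q_def fls_times_fps_to_fls fps_to_fls_power flip: mult.assoc)
next
  case (Suc i)
  define f where "f j = fps_to_fls ((delta ^^ j) shifted_Q)" for j
  have df: "fls_deriv (f j) = inverse fls_X ^ 2 * f (Suc j)" for j
  proof -
    have "inverse fls_X ^ 2 * (fls_X ^ 2 :: complex fls) = 1" by (simp flip: power_mult_distrib)
    moreover have "f (Suc j) = fls_X ^ 2 * fls_deriv (f j)"
      by (simp add: f_def delta_def[of "(delta ^^ j) _"] fls_times_fps_to_fls fps_to_fls_power fls_deriv_fps_to_fls)
    ultimately show ?thesis by (metis mult.assoc mult_1_left)
  qed
  have "fps_to_fls ((fps_deriv ^^ Suc i) QA_half) = fls_deriv (\<Sum>j\<le>i. deriv_coeff i j * f j)"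
    using Suc by (simp add: f_def flip: fls_deriv_fps_to_fls)
  also have "\<dots> = (\<Sum>j\<le>i. fls_deriv (deriv_coeff i j) * f j) + (\<Sum>j\<le>i. inverse fls_X ^ 2 * deriv_coeff i j * f (Suc j))"
    by (simp add: fls_deriv_sum df sum.distrib algebra_simps)
  also have "(\<Sum>j\<le>i. fls_deriv (deriv_coeff i j) * f j) = (\<Sum>j\<le>Suc i. fls_deriv (deriv_coeff i j) * f j)"
    by (simp add: deriv_coeff_upper)
  also have "(\<Sum>j\<le>i. inverse fls_X ^ 2 * deriv_coeff i j * f (Suc j))
      = (\<Sum>j\<le>Suc i. (if j = 0 then 0 else inverse fls_X ^ 2 * deriv_coeff i (j - 1)) * f j)"
    unfolding sum.atMost_Suc_shift by simp
  finally show ?case by (simp only: f_def deriv_coeff.simps distrib_right sum.distrib)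
qed

theorem strongly_diff_transcendental_QA_half: "strongly_diff_transcendental QA_half"
  unfolding strongly_diff_transcendental_def
proof (intro notI, elim exE conjE)
  fix m and c :: "(nat \<Rightarrow> nat) \<Rightarrow> complex fls"
  assume fin: "finite {e. c e \<noteq> 0}" and ne: "{e. c e \<noteq> 0} \<noteq> {}"
    and c: "\<forall>e. c e \<noteq> 0 \<longrightarrow> meromorphic_germ (c e) \<and> (\<forall>i>m. e i = 0)"
    and rel: "(\<Sum>e\<in>{e. c e \<noteq> 0}. c e * (\<Prod>i\<le>m. fps_to_fls ((fps_deriv ^^ i) QA_half) ^ e i)) = 0"
  define f where "f j = fps_to_fls ((delta ^^ j) shifted_Q)" for j
  define \<Phi> where "\<Phi> w = (\<Sum>e\<in>{e. c e \<noteq> 0}. c e * (\<Prod>i\<le>m. w i ^ e i))" for w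
  \<comment> \<open>The given relation rewritten in the iterates of \<open>delta\<close>, to which
    the independence result applies.\<close>
  define \<Psi> where "\<Psi> v = \<Phi> (\<lambda>i. \<Sum>j\<le>i. deriv_coeff i j * v j)" for v
  have "poly_fun {g. meromorphic_germ g} m \<Psi>"
    unfolding \<Psi>_def[abs_def] \<Phi>_def
    by (intro germs.poly_fun_sum germs.poly_fun_scale germs.poly_fun_prod_linear)
       (use c in \<open>auto simp: deriv_coeff_germ\<close>)
  then obtain d b where b: "\<And>M. meromorphic_germ (b M)" and \<Psi>: "\<And>v. \<Psi> v = (\<Sum>M\<in>msets m d. b M * monom_val v M)"
    unfolding poly_fun_def by auto
  have "\<Psi> f = 0"
    using rel by (simp add: \<Psi>_def \<Phi>_def f_def deriv_QA_expansion)
  then have "b M = 0" if "M \<in> msets m d" for M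
    using delta_iterates_independent[OF b _ that] \<Psi>[of f] by (simp add: f_def[abs_def])
  then have \<Psi>0: "\<Psi> v = 0" for v by (simp add: \<Psi>)
  \<comment> \<open>The change of variables is onto, so vanishing of \<open>\<Psi>\<close>
    everywhere passes to \<open>\<Phi>\<close>, whose coefficients are not all zero.\<close>
  have "\<Phi> w = 0" for w
  proof -
    obtain v where v: "\<And>i. i \<le> m \<Longrightarrow> (\<Sum>j\<le>i. deriv_coeff i j * v j) = w i"
      using triangular_solvable[of deriv_coeff m w] deriv_coeff_diag by blast
    have "\<Psi> v = \<Phi> w" unfolding \<Psi>_def \<Phi>_def by (simp add: v)
    then show ?thesis using \<Psi>0 by simp
  qed
  then show False
    using nonzero_coeffs_imp_nonzero_value[OF fin ne, of c m] c unfolding \<Phi>_def by blast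
qed

theorem theorem5p1:
  shows "QA_half = Abs_fps (\<lambda>k. if even k then
            complex_of_real (2 * (2 ^ (k + 2) - 1) * (-1) ^ (k div 2) / real (k div 2 + 1)
                             * bernoulli (k + 2))
          else 0)
    \<and> strongly_diff_transcendental QA_half
    \<and> (\<forall>n. 2 * QA_coeff (n + 1) =
            (\<Sum>l=1..n. real (n choose l) * QA_coeff (l - 1) * QA_coeff (n - l)))"
  by (intro conjI allI QA_half_eq strongly_diff_transcendental_QA_half QA_coeff_recurrence)

end
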